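(* Let $N\ge2$, $\alpha\in(0,1)$, let $\Omega\subset\mathbb{R}^N$ be an open, bounded and smooth domain with $0\in\Omega$, and let $p\ge\frac{N}{N-2\alpha}$. Then for any $\tau\in(-N,0)$ the problem $$(-\Delta)^\alpha u+|u|^{p-1}u=0\ \text{ in }\Omega\setminus\{0\},\qquad u=0\ \text{ in }\mathbb{R}^N\setminus\Omega,\qquad \lim_{x\to0}u(x)=+\infty$$ does not admit any solution $u$ such that $$0<\liminf_{x\to0}u(x)|x|^{-\tau}\le\limsup_{x\to0}u(x)|x|^{-\tau}<+\infty .$$
   Context: For $\alpha\in(0,1)$ the fractional Laplacian is $(-\Delta)^\alpha u(x)=\mathrm{P.V.}\int_{\mathbb{R}^N}\frac{u(x)-u(y)}{|x-y|^{N+2\alpha}}\,dy$. Solutions are classical: continuous on $\mathbb{R}^N\setminus\{0\}$, integrable near $0$, with the principal value existing and the equation holding at every $x\in\Omega\setminus\{0\}$. *)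

theory Defs
  imports "HOL-Analysis.Analysis"
begin

text \<open>The principal value removes closed balls around \<open>x\<close>: the truncated integral runs over
  \<open>\<bar>x - y\<bar> > \<epsilon>\<close> and \<open>\<epsilon>\<close> tends to \<open>0\<close> from above. No normalising constant is used.\<close>

definition frac_kernel :: "real \<Rightarrow> (real^'n \<Rightarrow> real) \<Rightarrow> real^'n \<Rightarrow> real^'n \<Rightarrow> real" where
  "frac_kernel \<alpha> u x y = (u x - u y) / norm (x - y) powr (real CARD('n) + 2 * \<alpha>)"

definition frac_trunc :: "real \<Rightarrow> (real^'n \<Rightarrow> real) \<Rightarrow> real^'n \<Rightarrow> real \<Rightarrow> real" where
  "frac_trunc \<alpha> u x \<epsilon> = (LINT y:{y. \<epsilon> < norm (x - y)}|lborel. frac_kernel \<alpha> u x y)"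

text \<open>Integrability of the truncations is required explicitly because the Bochner integral of a
  non-integrable function is \<open>0\<close> by convention.\<close>

definition frac_laplacian_exists :: "real \<Rightarrow> (real^'n \<Rightarrow> real) \<Rightarrow> real^'n \<Rightarrow> bool" where
  "frac_laplacian_exists \<alpha> u x \<longleftrightarrow>
     (\<forall>\<epsilon>>0. set_integrable lborel {y. \<epsilon> < norm (x - y)} (frac_kernel \<alpha> u x)) \<and>
     (\<exists>L. (frac_trunc \<alpha> u x \<longlongrightarrow> L) (at_right 0))"

definition frac_laplacian :: "real \<Rightarrow> (real^'n \<Rightarrow> real) \<Rightarrow> real^'n \<Rightarrow> real" where
  "frac_laplacian \<alpha> u x = Lim (at_right 0) (frac_trunc \<alpha> u x)"

primrec Ck_function :: "nat \<Rightarrow> ('a::euclidean_space \<Rightarrow> real) \<Rightarrow> bool" where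
  "Ck_function 0 f \<longleftrightarrow> continuous_on UNIV f"
| "Ck_function (Suc k) f \<longleftrightarrow>
     (\<forall>x. f differentiable (at x)) \<and> (\<forall>v. Ck_function k (\<lambda>x. frechet_derivative f (at x) v))"

definition smooth_function :: "('a::euclidean_space \<Rightarrow> real) \<Rightarrow> bool" where
  "smooth_function f \<longleftrightarrow> (\<forall>k. Ck_function k f)"

text \<open>Near each boundary point the set is the region above the graph of a smooth function of the
  remaining \<open>N - 1\<close> coordinates, in an orthonormal frame whose last vector is \<open>e\<close>. The function
  \<open>\<gamma>\<close> is evaluated only on the hyperplane orthogonal to \<open>e\<close>, which plays the role of
  \<open>(N - 1)\<close>-dimensional space.\<close>

definition smooth_boundary :: "'a::euclidean_space set \<Rightarrow> bool" where
  "smooth_boundary \<Omega> \<longleftrightarrow>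
     (\<forall>z\<in>frontier \<Omega>. \<exists>r>0. \<exists>e \<gamma>. norm e = 1 \<and> smooth_function \<gamma> \<and>
        \<Omega> \<inter> ball z r = {x \<in> ball z r. \<gamma> (x - (x \<bullet> e) *\<^sub>R e) < x \<bullet> e})"

text \<open>The value \<open>u 0\<close> is irrelevant: it affects the integrands only on a null set.\<close>

definition singular_solution ::
    "real \<Rightarrow> real \<Rightarrow> (real^'n) set \<Rightarrow> (real^'n \<Rightarrow> real) \<Rightarrow> bool" where
  "singular_solution \<alpha> p \<Omega> u \<longleftrightarrow>
     continuous_on (UNIV - {0}) u \<and>
     (\<exists>r>0. set_integrable lborel (ball 0 r) u) \<and>
     (\<forall>x\<in>\<Omega> - {0}. frac_laplacian_exists \<alpha> u x \<and>
        frac_laplacian \<alpha> u x + \<bar>u x\<bar> powr (p - 1) * u x = 0) \<and>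
     (\<forall>x\<in>UNIV - \<Omega>. u x = 0) \<and>
     filterlim u at_top (at 0)"

end

theory Submission
  imports Defs
begin

text \<open>Write \<open>N\<close> for the dimension. A solution \<open>u\<close> is touched from above, at a point \<open>x\<close> close to \<open>0\<close>, by
  \<open>M |y|\<^sup>\<tau> + k |y - x\<^sub>0|\<^sup>2\<close> with \<open>|x| \<approx> |x\<^sub>0| = R\<close> and \<open>k \<approx> h R\<^bsup>\<tau> - 2\<^esup>\<close>, where \<open>h\<close> bounds the
  oscillation of \<open>u |y|\<^bsup>-\<tau>\<^esup>\<close> about \<open>M\<close>. Evaluating the equation at \<open>x\<close> gives
  \<open>u(x)\<^sup>p \<le> - M \<kappa> |x|\<^bsup>\<tau> - 2\<alpha>\<^esup> + B (h R\<^bsup>\<tau> - 2\<alpha>\<^esup> + C R\<^bsup>- 2\<alpha>\<^esup>)\<close>,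
  where \<open>- \<kappa> |x|\<^bsup>\<tau> - 2\<alpha>\<^esup>\<close> is the contribution of the power \<open>|y|\<^sup>\<tau>\<close> and
  \<open>C\<close> bounds \<open>u\<close> away from the origin.
  If \<open>\<tau> \<ge> 2\<alpha> - N\<close>, take for \<open>M\<close> the upper limit of \<open>u |y|\<^bsup>-\<tau>\<^esup>\<close>, so that \<open>h\<close> may be chosen small:
  the power is superharmonic, strictly so for \<open>\<tau> > 2\<alpha> - N\<close>, while for \<open>\<tau> = 2\<alpha> - N\<close> one has
  \<open>\<tau> p \<le> \<tau> - 2\<alpha>\<close> and \<open>u\<^sup>p\<close> is too large. If \<open>\<tau> < 2\<alpha> - N\<close>, then \<open>\<tau> p < \<tau> - 2\<alpha>\<close>, and \<open>M = 0\<close> suffices.\<close>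

section \<open>Averaged polar coordinates and inversion\<close>

lemma nn_integral_lborel_scaleR:
  fixes f :: "'a::euclidean_space \<Rightarrow> ennreal"
  assumes [measurable]: "f \<in> borel_measurable borel" and c: "c > 0"
  shows "(\<integral>\<^sup>+y. f y \<partial>lborel) = ennreal (c ^ DIM('a)) * (\<integral>\<^sup>+y. f (c *\<^sub>R y) \<partial>lborel)"
proof -
  have "(\<integral>\<^sup>+y. f y \<partial>lborel)
      = (\<integral>\<^sup>+y. f y \<partial>density (distr lborel borel (\<lambda>y. 0 + c *\<^sub>R y)) (\<lambda>_. ennreal (\<bar>c\<bar> ^ DIM('a))))"
    using c lborel_affine[of c "0::'a"] by (simp del: add_0_left)
  also have "\<dots> = ennreal (c ^ DIM('a)) * (\<integral>\<^sup>+y. f (c *\<^sub>R y) \<partial>lborel)"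
    using c by (simp add: nn_integral_density nn_integral_distr nn_integral_cmult)
  finally show ?thesis .
qed

lemma nn_integral_inverse_Icc:
  assumes "0 < a" "a \<le> b"
  shows "(\<integral>\<^sup>+s. ennreal (1 / s) * indicator {a..b} s \<partial>lborel) = ennreal (ln b - ln a)"
  using assms by (intro nn_integral_FTC_Icc) (auto intro!: derivative_eq_intros)

text \<open>For fixed \<open>r\<close> either window confines \<open>s\<close> to an interval whose
  endpoints have ratio e, hence of length 1 for ds/s. This normalises the two averages below; the
  two forms serve radii written as \<open>s\<close> and as \<open>1 / t\<close>.\<close>

lemma nn_integral_log_window:
  assumes "r > 0"
  shows "(\<integral>\<^sup>+s. ennreal (1 / s) * indicator {0<..} s * indicator {1..exp 1} (r / s) \<partial>lborel) = 1"
    and "(\<integral>\<^sup>+s. ennreal (1 / s) * indicator {0<..} s * indicator {1..exp 1} (s * r) \<partial>lborel) = 1"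
proof -
  have "(\<integral>\<^sup>+s. ennreal (1 / s) * indicator {0<..} s * indicator {1..exp 1} (r / s) \<partial>lborel)
    = (\<integral>\<^sup>+s. ennreal (1 / s) * indicator {r / exp 1..r} s \<partial>lborel)"
  proof (intro nn_integral_cong)
    fix s :: real
    have "s > 0" if "r \<le> s * exp 1"
      using assms that by (metis exp_gt_zero less_le_trans zero_less_mult_pos2)
    then show "ennreal (1 / s) * indicator {0<..} s * indicator {1..exp 1} (r / s)
        = ennreal (1 / s) * indicator {r / exp 1..r} s"
      using assms by (auto simp: indicator_def field_simps)
  qed
  also have "\<dots> = ennreal (ln r - ln (r / exp 1))"
    using assms by (intro nn_integral_inverse_Icc) (auto simp: divide_simps)
  finally show "(\<integral>\<^sup>+s. ennreal (1 / s) * indicator {0<..} s * indicator {1..exp 1} (r / s) \<partial>lborel) = 1"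
    using assms by (simp add: ln_div)
  have "(\<integral>\<^sup>+s. ennreal (1 / s) * indicator {0<..} s * indicator {1..exp 1} (s * r) \<partial>lborel)
    = (\<integral>\<^sup>+s. ennreal (1 / s) * indicator {1 / r..exp 1 / r} s \<partial>lborel)"
  proof (intro nn_integral_cong)
    fix s :: real
    have "s > 0" if "1 \<le> s * r"
      using assms that by (metis less_le_trans zero_less_mult_pos2 zero_less_one)
    then show "ennreal (1 / s) * indicator {0<..} s * indicator {1..exp 1} (s * r)
        = ennreal (1 / s) * indicator {1 / r..exp 1 / r} s"
      using assms by (auto simp: indicator_def field_simps)
  qed
  also have "\<dots> = ennreal (ln (exp 1 / r) - ln (1 / r))"
    using assms by (intro nn_integral_inverse_Icc) (auto simp: divide_simps)
  finally show "(\<integral>\<^sup>+s. ennreal (1 / s) * indicator {0<..} s * indicator {1..exp 1} (s * r) \<partial>lborel) = 1"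
    using assms by (simp add: ln_div)
qed

text \<open>A substitute for polar coordinates: instead of over the unit sphere, \<open>z\<close> ranges over a shell whose
  radial extent has length \<open>1\<close> for the dilation invariant measure \<open>ds/s\<close>.\<close>

lemma nn_integral_polar_average:
  fixes f :: "'a::euclidean_space \<Rightarrow> ennreal"
  assumes [measurable]: "f \<in> borel_measurable borel"
  shows "(\<integral>\<^sup>+z. indicator {1..exp 1} (norm z) *
      (\<integral>\<^sup>+s. indicator {0<..} s * ennreal (s ^ DIM('a) / s) * f (s *\<^sub>R z) \<partial>lborel) \<partial>lborel)
    = (\<integral>\<^sup>+y. f y \<partial>lborel)"
proof -
  have "(\<integral>\<^sup>+z. indicator {1..exp 1} (norm z) *
      (\<integral>\<^sup>+s. indicator {0<..} s * ennreal (s ^ DIM('a) / s) * f (s *\<^sub>R z) \<partial>lborel) \<partial>lborel)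
    = (\<integral>\<^sup>+z. (\<integral>\<^sup>+s. indicator {1..exp 1} (norm z) *
        (indicator {0<..} s * ennreal (s ^ DIM('a) / s) * f (s *\<^sub>R z)) \<partial>lborel) \<partial>lborel)"
    by (simp add: nn_integral_cmult)
  also have "\<dots> = (\<integral>\<^sup>+s. (\<integral>\<^sup>+z. indicator {1..exp 1} (norm z) *
        (indicator {0<..} s * ennreal (s ^ DIM('a) / s) * f (s *\<^sub>R z)) \<partial>lborel) \<partial>lborel)"
    by (rule lborel_pair.Fubini') measurable
  \<comment> \<open>For fixed \<open>s\<close> the substitution y = s z removes the dilation from
    \<open>f\<close> and turns the shell condition on \<open>z\<close> into a window condition on
    \<open>s\<close>.\<close>
  also have "\<dots> = (\<integral>\<^sup>+s. (\<integral>\<^sup>+y. f y *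
        (ennreal (1 / s) * indicator {0<..} s * indicator {1..exp 1} (norm y / s)) \<partial>lborel) \<partial>lborel)"
  proof (rule nn_integral_cong)
    fix s :: real
    show "(\<integral>\<^sup>+z. indicator {1..exp 1} (norm z) *
        (indicator {0<..} s * ennreal (s ^ DIM('a) / s) * f (s *\<^sub>R z)) \<partial>lborel)
      = (\<integral>\<^sup>+y. f y * (ennreal (1 / s) * indicator {0<..} s * indicator {1..exp 1} (norm y / s)) \<partial>lborel)"
    proof (cases "s > 0")
      case True
      have "(\<integral>\<^sup>+y. f y * (ennreal (1 / s) * indicator {0<..} s * indicator {1..exp 1} (norm y / s)) \<partial>lborel)
        = ennreal (s ^ DIM('a)) * (\<integral>\<^sup>+z. f (s *\<^sub>R z) *
            (ennreal (1 / s) * indicator {0<..} s * indicator {1..exp 1} (norm (s *\<^sub>R z) / s)) \<partial>lborel)"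
        using True by (intro nn_integral_lborel_scaleR) measurable
      also have "\<dots> = (\<integral>\<^sup>+z. ennreal (s ^ DIM('a)) * (f (s *\<^sub>R z) *
            (ennreal (1 / s) * indicator {0<..} s * indicator {1..exp 1} (norm (s *\<^sub>R z) / s))) \<partial>lborel)"
        by (simp add: nn_integral_cmult)
      also have "\<dots> = (\<integral>\<^sup>+z. indicator {1..exp 1} (norm z) *
        (indicator {0<..} s * ennreal (s ^ DIM('a) / s) * f (s *\<^sub>R z)) \<partial>lborel)"
      proof (rule nn_integral_cong)
        fix z :: 'a
        have "ennreal (s ^ DIM('a) / s) = ennreal (s ^ DIM('a)) * ennreal (1 / s)"
          using True by (subst ennreal_mult'[symmetric]) auto
        then show "ennreal (s ^ DIM('a)) * (f (s *\<^sub>R z) *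
            (ennreal (1 / s) * indicator {0<..} s * indicator {1..exp 1} (norm (s *\<^sub>R z) / s)))
          = indicator {1..exp 1} (norm z) *
        (indicator {0<..} s * ennreal (s ^ DIM('a) / s) * f (s *\<^sub>R z))"
          using True by (simp add: ac_simps)
      qed
      finally show ?thesis by simp
    qed simp
  qed
  also have "\<dots> = (\<integral>\<^sup>+y. (\<integral>\<^sup>+s. f y *
        (ennreal (1 / s) * indicator {0<..} s * indicator {1..exp 1} (norm y / s)) \<partial>lborel) \<partial>lborel)"
    by (rule lborel_pair.Fubini') measurable
  also have "\<dots> = (\<integral>\<^sup>+y. f y * (\<integral>\<^sup>+s.
        (ennreal (1 / s) * indicator {0<..} s * indicator {1..exp 1} (norm y / s)) \<partial>lborel) \<partial>lborel)"
    by (simp add: nn_integral_cmult)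
  also have "\<dots> = (\<integral>\<^sup>+y. f y \<partial>lborel)"
  proof (rule nn_integral_cong_AE)
    \<comment> \<open>At the origin no \<open>s\<close> meets the window, so the inner integral is 0
      there instead of 1.\<close>
    have "AE y in lborel. (y::'a) \<noteq> 0"
      by (rule AE_lborel_singleton)
    then show "AE y in lborel. f y * (\<integral>\<^sup>+s.
        (ennreal (1 / s) * indicator {0<..} s * indicator {1..exp 1} (norm y / s)) \<partial>lborel) = f y"
      by eventually_elim (simp add: nn_integral_log_window)
  qed
  finally show ?thesis .
qed

text \<open>The measure ds/s is invariant under s = 1/t, so the radius may be written as 1/t. The
  computation repeats the previous one with y = z/t, which avoids a nonlinear substitution in one
  variable.\<close>

lemma nn_integral_polar_average_inverse:
  fixes f :: "'a::euclidean_space \<Rightarrow> ennreal"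
  assumes [measurable]: "f \<in> borel_measurable borel"
  shows "(\<integral>\<^sup>+z. indicator {1..exp 1} (norm z) *
      (\<integral>\<^sup>+t. indicator {0<..} t * ennreal (1 / (t * t ^ DIM('a))) * f (z /\<^sub>R t) \<partial>lborel) \<partial>lborel)
    = (\<integral>\<^sup>+y. f y \<partial>lborel)"
proof -
  have "(\<integral>\<^sup>+z. indicator {1..exp 1} (norm z) *
      (\<integral>\<^sup>+t. indicator {0<..} t * ennreal (1 / (t * t ^ DIM('a))) * f (z /\<^sub>R t) \<partial>lborel) \<partial>lborel)
    = (\<integral>\<^sup>+z. (\<integral>\<^sup>+t. indicator {1..exp 1} (norm z) *
        (indicator {0<..} t * ennreal (1 / (t * t ^ DIM('a))) * f (z /\<^sub>R t)) \<partial>lborel) \<partial>lborel)"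
    by (simp add: nn_integral_cmult)
  also have "\<dots> = (\<integral>\<^sup>+t. (\<integral>\<^sup>+z. indicator {1..exp 1} (norm z) *
        (indicator {0<..} t * ennreal (1 / (t * t ^ DIM('a))) * f (z /\<^sub>R t)) \<partial>lborel) \<partial>lborel)"
    by (rule lborel_pair.Fubini') measurable
  also have "\<dots> = (\<integral>\<^sup>+t. (\<integral>\<^sup>+y. f y *
        (ennreal (1 / t) * indicator {0<..} t * indicator {1..exp 1} (t * norm y)) \<partial>lborel) \<partial>lborel)"
  proof (rule nn_integral_cong)
    fix t :: real
    show "(\<integral>\<^sup>+z. indicator {1..exp 1} (norm z) *
        (indicator {0<..} t * ennreal (1 / (t * t ^ DIM('a))) * f (z /\<^sub>R t)) \<partial>lborel)
      = (\<integral>\<^sup>+y. f y * (ennreal (1 / t) * indicator {0<..} t * indicator {1..exp 1} (t * norm y)) \<partial>lborel)"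
    proof (cases "t > 0")
      case True
      have "(\<integral>\<^sup>+z. indicator {1..exp 1} (norm z) *
        (indicator {0<..} t * ennreal (1 / (t * t ^ DIM('a))) * f (z /\<^sub>R t)) \<partial>lborel)
        = ennreal (t ^ DIM('a)) * (\<integral>\<^sup>+y. indicator {1..exp 1} (norm (t *\<^sub>R y)) *
        (indicator {0<..} t * ennreal (1 / (t * t ^ DIM('a))) * f ((t *\<^sub>R y) /\<^sub>R t)) \<partial>lborel)"
        using True by (intro nn_integral_lborel_scaleR) measurable
      also have "\<dots> = (\<integral>\<^sup>+y. ennreal (t ^ DIM('a)) * (indicator {1..exp 1} (norm (t *\<^sub>R y)) *
        (indicator {0<..} t * ennreal (1 / (t * t ^ DIM('a))) * f ((t *\<^sub>R y) /\<^sub>R t))) \<partial>lborel)"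
        by (simp add: nn_integral_cmult)
      also have "\<dots> = (\<integral>\<^sup>+y. f y * (ennreal (1 / t) * indicator {0<..} t * indicator {1..exp 1} (t * norm y)) \<partial>lborel)"
      proof (rule nn_integral_cong)
        fix y :: 'a
        have "ennreal (1 / t) = ennreal (t ^ DIM('a)) * ennreal (1 / (t * t ^ DIM('a)))"
          using True by (subst ennreal_mult'[symmetric]) auto
        then show "ennreal (t ^ DIM('a)) * (indicator {1..exp 1} (norm (t *\<^sub>R y)) *
            (indicator {0<..} t * ennreal (1 / (t * t ^ DIM('a))) * f ((t *\<^sub>R y) /\<^sub>R t)))
          = f y * (ennreal (1 / t) * indicator {0<..} t * indicator {1..exp 1} (t * norm y))"
          using True by (simp add: ac_simps)
      qed
      finally show ?thesis .
    qed simp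
  qed
  also have "\<dots> = (\<integral>\<^sup>+y. (\<integral>\<^sup>+t. f y *
        (ennreal (1 / t) * indicator {0<..} t * indicator {1..exp 1} (t * norm y)) \<partial>lborel) \<partial>lborel)"
    by (rule lborel_pair.Fubini') measurable
  also have "\<dots> = (\<integral>\<^sup>+y. f y * (\<integral>\<^sup>+t.
        (ennreal (1 / t) * indicator {0<..} t * indicator {1..exp 1} (t * norm y)) \<partial>lborel) \<partial>lborel)"
    by (simp add: nn_integral_cmult)
  also have "\<dots> = (\<integral>\<^sup>+y. f y \<partial>lborel)"
  proof (rule nn_integral_cong_AE)
    have "AE y in lborel. (y::'a) \<noteq> 0"
      by (rule AE_lborel_singleton)
    then show "AE y in lborel. f y * (\<integral>\<^sup>+t.
        (ennreal (1 / t) * indicator {0<..} t * indicator {1..exp 1} (t * norm y)) \<partial>lborel) = f y"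
      by eventually_elim (simp add: nn_integral_log_window)
  qed
  finally show ?thesis .
qed

text \<open>Inversion maps each ray to itself and acts on its radius by a reciprocal. Averaging the
  left side over radii 1/t and the right side over radii s therefore leaves, on each ray, only a
  linear substitution; the Jacobian (R / |y|)^(2N) comes out without differentiating the
  inversion.\<close>

lemma nn_integral_inversion:
  fixes f :: "'a::euclidean_space \<Rightarrow> ennreal"
  assumes [measurable]: "f \<in> borel_measurable borel" and R: "R > 0"
  shows "(\<integral>\<^sup>+y. f ((R\<^sup>2 / (norm y)\<^sup>2) *\<^sub>R y) * ennreal ((R / norm y) ^ (2 * DIM('a))) \<partial>lborel)
    = (\<integral>\<^sup>+y. f y \<partial>lborel)"
proof -
  let ?F = "\<lambda>y::'a. f ((R\<^sup>2 / (norm y)\<^sup>2) *\<^sub>R y) * ennreal ((R / norm y) ^ (2 * DIM('a)))"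
  have "(\<integral>\<^sup>+y. ?F y \<partial>lborel) = (\<integral>\<^sup>+z. indicator {1..exp 1} (norm z) *
      (\<integral>\<^sup>+t. indicator {0<..} t * ennreal (1 / (t * t ^ DIM('a))) * ?F (z /\<^sub>R t) \<partial>lborel) \<partial>lborel)"
    by (rule nn_integral_polar_average_inverse[symmetric]) measurable
  also have "\<dots> = (\<integral>\<^sup>+z. indicator {1..exp 1} (norm z) *
      (\<integral>\<^sup>+s. indicator {0<..} s * ennreal (s ^ DIM('a) / s) * f (s *\<^sub>R z) \<partial>lborel) \<partial>lborel)"
  proof (rule nn_integral_cong)
    fix z :: 'a
    show "indicator {1..exp 1} (norm z) *
      (\<integral>\<^sup>+t. indicator {0<..} t * ennreal (1 / (t * t ^ DIM('a))) * ?F (z /\<^sub>R t) \<partial>lborel)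
      = indicator {1..exp 1} (norm z) *
      (\<integral>\<^sup>+s. indicator {0<..} s * ennreal (s ^ DIM('a) / s) * f (s *\<^sub>R z) \<partial>lborel)"
    proof (cases "z = 0")
      case False
      \<comment> \<open>On the ray through \<open>z\<close> the inversion sends z/t to (c t) z, so
        the substitution is s = c t.\<close>
      define c where "c = R\<^sup>2 / (norm z)\<^sup>2"
      have c: "c > 0" using False R by (simp add: c_def)
      have "(\<integral>\<^sup>+s. indicator {0<..} s * ennreal (s ^ DIM('a) / s) * f (s *\<^sub>R z) \<partial>lborel)
        = ennreal c * (\<integral>\<^sup>+t. indicator {0<..} (c * t) * ennreal ((c * t) ^ DIM('a) / (c * t)) * f ((c * t) *\<^sub>R z) \<partial>lborel)"
        using nn_integral_lborel_scaleR[of "\<lambda>s. indicator {0<..} s * ennreal (s ^ DIM('a) / s) * f (s *\<^sub>R z)" c] c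
        by simp
      also have "\<dots> = (\<integral>\<^sup>+t. ennreal c * (indicator {0<..} (c * t) * ennreal ((c * t) ^ DIM('a) / (c * t)) * f ((c * t) *\<^sub>R z)) \<partial>lborel)"
        by (simp add: nn_integral_cmult)
      also have "\<dots> = (\<integral>\<^sup>+t. indicator {0<..} t * ennreal (1 / (t * t ^ DIM('a))) * ?F (z /\<^sub>R t) \<partial>lborel)"
      proof (rule nn_integral_cong)
        fix t :: real
        show "ennreal c * (indicator {0<..} (c * t) * ennreal ((c * t) ^ DIM('a) / (c * t)) * f ((c * t) *\<^sub>R z))
          = indicator {0<..} t * ennreal (1 / (t * t ^ DIM('a))) * ?F (z /\<^sub>R t)"
        proof (cases "t > 0")
          case True
          have 1: "(R\<^sup>2 / (norm (z /\<^sub>R t))\<^sup>2) *\<^sub>R (z /\<^sub>R t) = (c * t) *\<^sub>R z"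
            using True False by (simp add: c_def field_simps power2_eq_square)
          have "(R / norm (z /\<^sub>R t)) ^ (2 * DIM('a)) = (c * t\<^sup>2) ^ DIM('a)"
            using True False by (simp add: c_def power_mult divide_simps power_mult_distrib)
          then have 2: "1 / (t * t ^ DIM('a)) * (R / norm (z /\<^sub>R t)) ^ (2 * DIM('a)) = c * ((c * t) ^ DIM('a) / (c * t))"
            using True c by (simp add: power_mult_distrib power2_eq_square field_simps)
          have "ennreal (1 / (t * t ^ DIM('a))) * ennreal ((R / norm (z /\<^sub>R t)) ^ (2 * DIM('a)))
            = ennreal c * ennreal ((c * t) ^ DIM('a) / (c * t))"
            using True c R by (subst (1 2) ennreal_mult[symmetric]) (simp_all only: 2, simp_all)
          then show ?thesis unfolding 1 using True c
            by (simp add: ac_simps)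
        qed (use c in \<open>simp add: zero_less_mult_iff\<close>)
      qed
      finally show ?thesis by simp
    qed simp
  qed
  also have "\<dots> = (\<integral>\<^sup>+y. f y \<partial>lborel)"
    by (rule nn_integral_polar_average) measurable
  finally show ?thesis .
qed

section \<open>Radial powers\<close>

lemma lborel_distr_reflect: "distr lborel borel (\<lambda>y. x - y) = (lborel :: 'a::euclidean_space measure)"
  using lborel_affine[of "-1" x] by (simp add: density_1)

text \<open>Reflection and dilation reduce everything to x = 0 and r = 1, whose integral is the
  constant \<open>C\<close>. The set \<open>J\<close> of admissible radii is a parameter so that
  balls and their exteriors share one scaling computation.\<close>

lemma has_bochner_integral_radial_powr:
  fixes J :: "real set" and p :: real
  assumes [measurable]: "J \<in> sets borel"
    and fin: "(\<integral>\<^sup>+y. indicator J (norm (y::'a::euclidean_space)) * ennreal (norm y powr p) \<partial>lborel) < \<infinity>"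
  shows "\<exists>C\<ge>0. \<forall>(x::'a) r. r > 0 \<longrightarrow>
    has_bochner_integral lborel (\<lambda>y. indicator J (norm (x - y) / r) * norm (x - y) powr p) (C * r powr (real DIM('a) + p))"
proof -
  define C where "C = enn2real (\<integral>\<^sup>+y. indicator J (norm (y::'a)) * ennreal (norm y powr p) \<partial>lborel)"
  have C: "(\<integral>\<^sup>+y. indicator J (norm (y::'a)) * ennreal (norm y powr p) \<partial>lborel) = ennreal C"
    using fin by (simp add: C_def)
  have C0: "C \<ge> 0" by (simp add: C_def)
  have "has_bochner_integral lborel (\<lambda>y. indicator J (norm (x - y) / r) * norm (x - y) powr p) (C * r powr (real DIM('a) + p))"
    if r: "r > 0" for x :: 'a and r
  proof -
    have "(\<integral>\<^sup>+y. ennreal (indicator J (norm (x - y) / r) * norm (x - y) powr p) \<partial>lborel)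
      = (\<integral>\<^sup>+y. ennreal (indicator J (norm y / r) * norm y powr p) \<partial>distr lborel borel (\<lambda>y. x - y))"
      by (simp add: nn_integral_distr)
    also have "\<dots> = (\<integral>\<^sup>+y. ennreal (indicator J (norm (y::'a) / r) * norm y powr p) \<partial>lborel)"
      by (simp add: lborel_distr_reflect)
    also have "\<dots> = ennreal (r ^ DIM('a)) * (\<integral>\<^sup>+y. ennreal (indicator J (norm (r *\<^sub>R (y::'a)) / r) * norm (r *\<^sub>R y) powr p) \<partial>lborel)"
      by (rule nn_integral_lborel_scaleR) (use r in auto)
    also have "(\<integral>\<^sup>+y. ennreal (indicator J (norm (r *\<^sub>R (y::'a)) / r) * norm (r *\<^sub>R y) powr p) \<partial>lborel)
      = (\<integral>\<^sup>+y. ennreal (r powr p) * (indicator J (norm (y::'a)) * ennreal (norm y powr p)) \<partial>lborel)"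
      using r by (intro nn_integral_cong) (auto simp: indicator_def powr_mult ennreal_mult')
    also have "\<dots> = ennreal (r powr p) * ennreal C"
      by (subst nn_integral_cmult) (auto simp: C)
    finally have "(\<integral>\<^sup>+y. ennreal (indicator J (norm (x - y) / r) * norm (x - y) powr p) \<partial>lborel)
      = ennreal (C * r powr (real DIM('a) + p))"
      using r C0 by (simp add: powr_add powr_realpow ennreal_mult'[symmetric] ac_simps flip: ennreal_mult)
    then show ?thesis
      using C0 by (intro has_bochner_integral_nn_integral) auto
  qed
  with C0 show ?thesis by blast
qed

section \<open>Convergence of power integrals near the origin and at infinity\<close>

lemma nn_integral_powr_0_1:
  assumes "a > 0"
  shows "(\<integral>\<^sup>+s. ennreal (s powr (a - 1)) * indicator {0..1} s \<partial>lborel) < \<infinity>"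
proof -
  have "((\<lambda>s. s powr (a - 1)) has_integral (1 powr (a - 1 + 1) / (a - 1 + 1))) {0..1::real}"
    by (rule has_integral_powr_from_0) (use assms in auto)
  from nn_integral_has_integral_lebesgue[OF _ this]
  have "(\<integral>\<^sup>+s. ennreal (indicator {0..1} s * s powr (a - 1)) \<partial>lborel) < \<infinity>"
    by simp
  then show ?thesis
    by (simp add: ennreal_mult' ennreal_indicator mult.commute)
qed

lemma nn_integral_powr_tail:
  assumes "a < 0" "c > 0"
  shows "(\<integral>\<^sup>+s. ennreal (s powr (a - 1)) * indicator {c..} s \<partial>lborel) < \<infinity>"
proof -
  have "((\<lambda>s. s powr (a - 1)) has_integral (- (c powr (a - 1 + 1)) / (a - 1 + 1))) {c..}"
    by (rule has_integral_powr_to_inf) (use assms in auto)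
  from nn_integral_has_integral_lebesgue[OF _ this]
  have "(\<integral>\<^sup>+s. ennreal (indicator {c..} s * s powr (a - 1)) \<partial>lborel) < \<infinity>"
    by simp
  then show ?thesis
    by (simp add: ennreal_mult' ennreal_indicator mult.commute)
qed

text \<open>In the polar average the shell contributes bounded factors only, and what remains is the
  integral of s^(N + p - 1) near 0, which converges since N + p > 0.\<close>

lemma nn_integral_powr_ball:
  assumes "- real DIM('a) < p"
  shows "(\<integral>\<^sup>+y. indicator {..<1} (norm (y::'a::euclidean_space)) * ennreal (norm y powr p) \<partial>lborel) < \<infinity>"
proof -
  define D where "D = (\<integral>\<^sup>+s. ennreal (s powr ((real DIM('a) + p) - 1)) * indicator {0..1} s \<partial>lborel)"
  have D: "D < \<infinity>" unfolding D_def by (rule nn_integral_powr_0_1) (use assms in simp)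
  let ?f = "\<lambda>y::'a. indicator {..<1} (norm y) * ennreal (norm y powr p)"
  have "(\<integral>\<^sup>+y. ?f y \<partial>lborel) = (\<integral>\<^sup>+z. indicator {1..exp 1} (norm z) *
      (\<integral>\<^sup>+s. indicator {0<..} s * ennreal (s ^ DIM('a) / s) * ?f (s *\<^sub>R z) \<partial>lborel) \<partial>lborel)"
    by (rule nn_integral_polar_average[symmetric]) measurable
  also have "\<dots> \<le> (\<integral>\<^sup>+z. (ennreal (1 + exp 1 powr p) * D) * indicator (cball 0 (exp 1)) (z::'a) \<partial>lborel)"
  proof (rule nn_integral_mono)
    fix z :: 'a
    show "indicator {1..exp 1} (norm z) *
      (\<integral>\<^sup>+s. indicator {0<..} s * ennreal (s ^ DIM('a) / s) * ?f (s *\<^sub>R z) \<partial>lborel)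
      \<le> (ennreal (1 + exp 1 powr p) * D) * indicator (cball 0 (exp 1)) z"
    proof (cases "norm z \<in> {1..exp 1}")
      case True
      \<comment> \<open>The sum \<open>1 + exp 1 powr p\<close> bounds the power on the shell for
        either sign of \<open>p\<close>.\<close>
      have zp: "norm z powr p \<le> 1 + exp 1 powr p"
      proof (cases "p \<ge> 0")
        case p: True
        have "norm z powr p \<le> exp 1 powr p" using True p by (intro powr_mono2) auto
        then show ?thesis by simp
      next
        case False
        have "norm z powr p \<le> 1" using True False powr_mono2'[of p 1 "norm z"] by auto
        then show ?thesis by (simp add: add_increasing2)
      qed
      have "(\<integral>\<^sup>+s. indicator {0<..} s * ennreal (s ^ DIM('a) / s) * ?f (s *\<^sub>R z) \<partial>lborel)
        \<le> (\<integral>\<^sup>+s. ennreal (1 + exp 1 powr p) * (ennreal (s powr ((real DIM('a) + p) - 1)) * indicator {0..1} s) \<partial>lborel)"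
      proof (rule nn_integral_mono)
        fix s :: real
        show "indicator {0<..} s * ennreal (s ^ DIM('a) / s) * ?f (s *\<^sub>R z)
          \<le> ennreal (1 + exp 1 powr p) * (ennreal (s powr ((real DIM('a) + p) - 1)) * indicator {0..1} s)"
        proof (cases "s > 0 \<and> s * norm z < 1")
          case s: True
          have "s * 1 \<le> s * norm z" using s True by (intro mult_left_mono) auto
          then have "s \<le> 1" using s by linarith
          have "s ^ DIM('a) / s * norm (s *\<^sub>R z) powr p = s powr ((real DIM('a) + p) - 1) * norm z powr p"
            using s by (simp add: powr_mult powr_diff powr_add powr_realpow)
          also have "\<dots> \<le> s powr ((real DIM('a) + p) - 1) * (1 + exp 1 powr p)"
            by (intro mult_left_mono zp) auto
          finally have le: "s ^ DIM('a) / s * norm (s *\<^sub>R z) powr p \<le> s powr ((real DIM('a) + p) - 1) * (1 + exp 1 powr p)" .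
          have "ennreal (s ^ DIM('a) / s) * ennreal (norm (s *\<^sub>R z) powr p)
            \<le> ennreal (1 + exp 1 powr p) * ennreal (s powr ((real DIM('a) + p) - 1))"
            using s ennreal_leI[OF le]
            by (subst (1 2) ennreal_mult[symmetric]) (simp_all only: mult.commute, simp_all)
          then show ?thesis using s \<open>s \<le> 1\<close>
            by (simp add: indicator_def del: ennreal_plus)
        next
          case False
          then show ?thesis by (cases "s > 0") (auto simp: indicator_def)
        qed
      qed
      also have "\<dots> = ennreal (1 + exp 1 powr p) * D"
        unfolding D_def by (rule nn_integral_cmult) measurable
      finally show ?thesis using True by simp
    qed simp
  qed
  also have "\<dots> = (ennreal (1 + exp 1 powr p) * D) * emeasure lborel (cball (0::'a) (exp 1))"
    by (rule nn_integral_cmult_indicator) simp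
  also have "\<dots> < \<infinity>"
    using D by (simp add: ennreal_mult_less_top emeasure_cball)
  finally show ?thesis .
qed

lemma nn_integral_powr_outside:
  assumes "p < - real DIM('a)"
  shows "(\<integral>\<^sup>+y. indicator {1..} (norm (y::'a::euclidean_space)) * ennreal (norm y powr p) \<partial>lborel) < \<infinity>"
proof -
  \<comment> \<open>On the shell |z| \<le> e, so |s z| \<ge> 1 forces s \<ge> 1/e; this is where the
    tail starts.\<close>
  define D where "D = (\<integral>\<^sup>+s. ennreal (s powr ((real DIM('a) + p) - 1)) * indicator {exp (-1)..} s \<partial>lborel)"
  have D: "D < \<infinity>" unfolding D_def by (rule nn_integral_powr_tail) (use assms in auto)
  let ?f = "\<lambda>y::'a. indicator {1..} (norm y) * ennreal (norm y powr p)"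
  have "(\<integral>\<^sup>+y. ?f y \<partial>lborel) = (\<integral>\<^sup>+z. indicator {1..exp 1} (norm z) *
      (\<integral>\<^sup>+s. indicator {0<..} s * ennreal (s ^ DIM('a) / s) * ?f (s *\<^sub>R z) \<partial>lborel) \<partial>lborel)"
    by (rule nn_integral_polar_average[symmetric]) measurable
  also have "\<dots> \<le> (\<integral>\<^sup>+z. D * indicator (cball 0 (exp 1)) (z::'a) \<partial>lborel)"
  proof (rule nn_integral_mono)
    fix z :: 'a
    show "indicator {1..exp 1} (norm z) *
      (\<integral>\<^sup>+s. indicator {0<..} s * ennreal (s ^ DIM('a) / s) * ?f (s *\<^sub>R z) \<partial>lborel)
      \<le> D * indicator (cball 0 (exp 1)) z"
    proof (cases "norm z \<in> {1..exp 1}")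
      case True
      have "p \<le> 0" using assms by (smt (verit) of_nat_0_le_iff)
      then have zp: "norm z powr p \<le> 1" using True powr_mono2'[of p 1 "norm z"] by auto
      have "(\<integral>\<^sup>+s. indicator {0<..} s * ennreal (s ^ DIM('a) / s) * ?f (s *\<^sub>R z) \<partial>lborel) \<le> D"
        unfolding D_def
      proof (rule nn_integral_mono)
        fix s :: real
        show "indicator {0<..} s * ennreal (s ^ DIM('a) / s) * ?f (s *\<^sub>R z)
          \<le> ennreal (s powr ((real DIM('a) + p) - 1)) * indicator {exp (-1)..} s"
        proof (cases "s > 0 \<and> s * norm z \<ge> 1")
          case s: True
          have "s * norm z \<le> s * exp 1" using s True by (intro mult_left_mono) auto
          then have "1 \<le> s * exp 1" using s by linarith
          then have "exp (-1) \<le> s" by (simp add: exp_minus field_simps)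
          have "s ^ DIM('a) / s * norm (s *\<^sub>R z) powr p = s powr ((real DIM('a) + p) - 1) * norm z powr p"
            using s by (simp add: powr_mult powr_diff powr_add powr_realpow)
          also have "\<dots> \<le> s powr ((real DIM('a) + p) - 1) * 1"
            by (intro mult_left_mono zp) auto
          finally show ?thesis using s \<open>exp (-1) \<le> s\<close>
            by (simp add: indicator_def flip: ennreal_mult' ennreal_mult'')
        next
          case False
          then show ?thesis by (cases "s > 0") (auto simp: indicator_def)
        qed
      qed
      then show ?thesis using True by simp
    qed simp
  qed
  also have "\<dots> = D * emeasure lborel (cball (0::'a) (exp 1))"
    by (rule nn_integral_cmult_indicator) simp
  also have "\<dots> < \<infinity>"
    using D by (simp add: ennreal_mult_less_top emeasure_cball)
  finally show ?thesis .
qed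

section \<open>Scaling of the kernel integrals\<close>

lemma has_bochner_integral_tail_kernel:
  assumes "\<alpha> > 0"
  shows "\<exists>C\<ge>0. \<forall>(x::'a::euclidean_space) r. r > 0 \<longrightarrow>
    has_bochner_integral lborel
      (\<lambda>y. indicator {y. r \<le> norm (x - y)} y * norm (x - y) powr (- (real DIM('a) + 2 * \<alpha>))) (C * r powr (- 2 * \<alpha>))"
proof -
  obtain C where C: "C \<ge> 0" "\<And>x r. r > 0 \<Longrightarrow> has_bochner_integral lborel
      (\<lambda>y::'a. indicator {1..} (norm (x - y) / r) * norm (x - y) powr (- (real DIM('a) + 2 * \<alpha>)))
      (C * r powr (real DIM('a) + - (real DIM('a) + 2 * \<alpha>)))"
    using has_bochner_integral_radial_powr[OF _ nn_integral_powr_outside, of "- (real DIM('a) + 2 * \<alpha>)", where 'a = 'a] assms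
    by auto
  have "indicator {1..} (norm (x - y) / r) = (indicator {y. r \<le> norm (x - y)} y :: real)"
    if "r > 0" for x y :: 'a and r
    using that by (auto simp: indicator_def)
  with C show ?thesis by (auto simp: mult.commute cong: has_bochner_integral_cong)
qed

lemma has_bochner_integral_ball_powr:
  assumes "- real DIM('a) < p"
  shows "\<exists>C\<ge>0. \<forall>(x::'a::euclidean_space) r. r > 0 \<longrightarrow>
    has_bochner_integral lborel (\<lambda>y. indicator (ball x r) y * norm (x - y) powr p) (C * r powr (real DIM('a) + p))"
proof -
  obtain C where C: "C \<ge> 0" "\<And>x r. r > 0 \<Longrightarrow> has_bochner_integral lborel
      (\<lambda>y::'a. indicator {..<1} (norm (x - y) / r) * norm (x - y) powr p) (C * r powr (real DIM('a) + p))"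
    using has_bochner_integral_radial_powr[OF _ nn_integral_powr_ball, of p, where 'a = 'a] assms
    by auto
  have "indicator {..<1} (norm (x - y) / r) = (indicator (ball x r) y :: real)"
    if "r > 0" for x y :: 'a and r
    using that by (auto simp: indicator_def dist_norm)
  with C show ?thesis by (auto cong: has_bochner_integral_cong)
qed

text \<open>Wherever \<open>x\<close> lies relative to the origin, one of the two factors is
  harmless. For |y| < r the kernel is at most r^(-N - 2\<alpha>), while |y|^\<tau> is integrable
  because \<tau> > -N; for |y| \<ge> r the power is at most r^\<tau> and the kernel is integrable.
  Both parts scale like r^(\<tau> - 2\<alpha>).\<close>

lemma integral_tail_power_kernel:
  assumes "\<alpha> > 0" "- real DIM('a) < \<tau>" "\<tau> \<le> 0"
  shows "\<exists>C\<ge>0. \<forall>(x::'a::euclidean_space) r. r > 0 \<longrightarrow>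
    integrable lborel (\<lambda>y. indicator {y. r \<le> norm (x - y)} y * (norm y powr \<tau> * norm (x - y) powr (- (real DIM('a) + 2 * \<alpha>)))) \<and>
    (LINT y|lborel. indicator {y. r \<le> norm (x - y)} y * (norm y powr \<tau> * norm (x - y) powr (- (real DIM('a) + 2 * \<alpha>))))
      \<le> C * r powr (\<tau> - 2 * \<alpha>)"
proof -
  let ?p = "- (real DIM('a) + 2 * \<alpha>)"
  obtain C2 where C2: "C2 \<ge> 0" "\<And>x r. r > 0 \<Longrightarrow> has_bochner_integral lborel
      (\<lambda>y::'a. indicator {y. r \<le> norm (x - y)} y * norm (x - y) powr ?p) (C2 * r powr (- 2 * \<alpha>))"
    using has_bochner_integral_tail_kernel[OF assms(1), where 'a = 'a] by auto
  obtain C3 where C3: "C3 \<ge> 0" "\<And>x r. r > 0 \<Longrightarrow> has_bochner_integral lborel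
      (\<lambda>y::'a. indicator (ball x r) y * norm (x - y) powr \<tau>) (C3 * r powr (real DIM('a) + \<tau>))"
    using has_bochner_integral_ball_powr[OF assms(2)] by auto
  have "integrable lborel (\<lambda>y. indicator {y. r \<le> norm (x - y)} y * (norm y powr \<tau> * norm (x - y) powr ?p)) \<and>
    (LINT y|lborel. indicator {y. r \<le> norm (x - y)} y * (norm y powr \<tau> * norm (x - y) powr ?p))
      \<le> (C3 + C2) * r powr (\<tau> - 2 * \<alpha>)" if r: "r > 0" for x :: 'a and r
  proof -
    let ?f = "\<lambda>y. indicator {y. r \<le> norm (x - y)} y * (norm y powr \<tau> * norm (x - y) powr ?p)"
    let ?g = "\<lambda>y. r powr ?p * (indicator (ball 0 r) y * norm (0 - y) powr \<tau>)
        + r powr \<tau> * (indicator {y. r \<le> norm (x - y)} y * norm (x - y) powr ?p)"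
    have "has_bochner_integral lborel ?g
        (r powr ?p * (C3 * r powr (real DIM('a) + \<tau>)) + r powr \<tau> * (C2 * r powr (- 2 * \<alpha>)))"
      using C2(2)[OF r, of x] C3(2)[OF r, of 0] by (intro has_bochner_integral_add has_bochner_integral_mult_right)
    also have "r powr ?p * (C3 * r powr (real DIM('a) + \<tau>)) + r powr \<tau> * (C2 * r powr (- 2 * \<alpha>))
        = (C3 + C2) * r powr (\<tau> - 2 * \<alpha>)"
      by (simp add: distrib_right mult.left_commute flip: powr_add)
    finally have g: "integrable lborel ?g" "integral\<^sup>L lborel ?g = (C3 + C2) * r powr (\<tau> - 2 * \<alpha>)"
      by (auto simp: has_bochner_integral_iff)
    have fg: "?f y \<le> ?g y" for y
    proof (cases "r \<le> norm (x - y)")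
      case True
      show ?thesis
      proof (cases "norm y < r")
        case y: True
        have "norm (x - y) powr ?p \<le> r powr ?p"
          using True r assms by (intro powr_mono2') auto
        then have "norm y powr \<tau> * norm (x - y) powr ?p \<le> r powr ?p * norm y powr \<tau>"
          by (simp add: mult_left_mono mult.commute)
        then show ?thesis using True y by (auto simp: indicator_def add_increasing2)
      next
        case False
        then have "norm y powr \<tau> \<le> r powr \<tau>"
          using r assms by (intro powr_mono2') auto
        then show ?thesis using True False by (auto simp: indicator_def mult_right_mono)
      qed
    qed (auto simp: indicator_def)
    have [measurable]: "?f \<in> borel_measurable lborel" by measurable
    have f: "integrable lborel ?f"
      by (rule Bochner_Integration.integrable_bound[OF g(1)])
        (use fg in \<open>auto intro!: AE_I2 order_trans[OF _ abs_ge_self]\<close>)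
    have "integral\<^sup>L lborel ?f \<le> integral\<^sup>L lborel ?g"
      using f g(1) fg by (rule integral_mono)
    with f g(2) show ?thesis by simp
  qed
  then show ?thesis using C2(1) C3(1) by (intro exI[of _ "C3 + C2"]) auto
qed

section \<open>Superharmonicity of powers\<close>

text \<open>Since \<open>x\<close> lies on the sphere of inversion it is a fixed point, and the
  distance formula |T x - T y| = R^2 |x - y| / (|x| |y|) with R = |x| takes this form.\<close>

lemma norm_diff_inversion:
  fixes x y :: "'a::real_inner"
  assumes "y \<noteq> 0"
  shows "norm (x - ((norm x)\<^sup>2 / (norm y)\<^sup>2) *\<^sub>R y) = norm x * norm (x - y) / norm y"
proof (rule power2_eq_imp_eq)
  have expand: "(norm (x - c *\<^sub>R y))\<^sup>2 = (norm x)\<^sup>2 - 2 * c * (x \<bullet> y) + c * c * (norm y)\<^sup>2" for c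
    by (simp add: power2_norm_eq_inner inner_diff inner_commute algebra_simps)
  have e1: "(norm (x - y))\<^sup>2 = (norm x)\<^sup>2 - 2 * (x \<bullet> y) + (norm y)\<^sup>2"
    using expand[of 1] by simp
  show "(norm (x - ((norm x)\<^sup>2 / (norm y)\<^sup>2) *\<^sub>R y))\<^sup>2 = (norm x * norm (x - y) / norm y)\<^sup>2"
    using assms unfolding expand power_mult_distrib power_divide
    by (simp add: e1 field_simps)
qed auto

text \<open>A lower bound, up to scaling, for the contribution of the ball \<open>|y| < |x| / 2\<close> to the integral below.\<close>

definition superharmonicity_constant :: "nat \<Rightarrow> real \<Rightarrow> real \<Rightarrow> real" where
  "superharmonicity_constant n \<alpha> \<tau> =
    (2 powr (- \<tau>) - 1) * (2 powr (real n + \<tau> - 2 * \<alpha>) - 1) * (3 / 2) powr (- (real n + 2 * \<alpha>))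
      * unit_ball_vol (real n) * (1 / 2) ^ n"

lemma superharmonicity_constant_nonneg:
  "\<tau> < 0 \<Longrightarrow> 2 * \<alpha> - real n \<le> \<tau> \<Longrightarrow> 0 \<le> superharmonicity_constant n \<alpha> \<tau>"
  by (auto simp: superharmonicity_constant_def intro!: mult_nonneg_nonneg ge_one_powr_ge_zero)

text \<open>Strictness of the bound on \<tau> enters through the factor
  \<open>2 powr (real n + \<tau> - 2 * \<alpha>) - 1\<close>. It vanishes at \<tau> = 2\<alpha> - N,
  the exponent of the fundamental solution.\<close>

lemma superharmonicity_constant_pos:
  "\<tau> < 0 \<Longrightarrow> 2 * \<alpha> - real n < \<tau> \<Longrightarrow> 0 < superharmonicity_constant n \<alpha> \<tau>"
  by (auto simp: superharmonicity_constant_def intro!: mult_pos_pos)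

text \<open>The inversion \<open>T\<close> in the sphere \<open>|y| = |x|\<close> carries the exterior part of the integral to the interior.
  For \<open>s = |y| / |x| < 1\<close> the two integrands then combine to the negative of
  \<open>(s\<^sup>\<tau> - 1) (s\<^bsup>2\<alpha> - N - \<tau>\<^esup> - 1) \<ge> 0\<close>. The truncation is not invariant under \<open>T\<close>, but \<open>|x - T y| \<ge> |x - y|\<close>
  for \<open>|y| < |x|\<close>, so the discrepancy lies in the exterior, where the integrand is negative.\<close>

lemma truncated_integral_power_le:
  fixes x :: "'a::euclidean_space"
  assumes \<alpha>: "\<alpha> > 0" and \<tau>: "- real DIM('a) < \<tau>" "\<tau> < 0" "2 * \<alpha> - real DIM('a) \<le> \<tau>"
    and \<epsilon>: "0 < \<epsilon>" "\<epsilon> < norm x / 2"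
  shows "(LINT y|lborel. indicator {y. \<epsilon> < norm (x - y)} y *
      ((norm y powr \<tau> - norm x powr \<tau>) * norm (x - y) powr (- (real DIM('a) + 2 * \<alpha>))))
    \<le> - superharmonicity_constant DIM('a) \<alpha> \<tau> * norm x powr (\<tau> - 2 * \<alpha>)"
proof -
  define N where "N = real DIM('a)"
  define R where "R = norm x"
  define q where "q = - (N + 2 * \<alpha>)"
  have R: "R > 0" "\<epsilon> < R / 2" using \<epsilon> by (auto simp: R_def)
  have N: "N > 0" by (simp add: N_def)
  define E where "E = {y. \<epsilon> < norm (x - y)}"
  have [measurable]: "E \<in> sets borel" unfolding E_def by measurable
  define F where "F y = (norm y powr \<tau> - R powr \<tau>) * norm (x - y) powr q" for y
  have [measurable]: "F \<in> borel_measurable borel" unfolding F_def by measurable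
  \<comment> \<open>\<open>P\<close> and \<open>Q\<close> are the interior and exterior parts of the
    truncated integrand, with signs chosen so that both are nonnegative almost everywhere.\<close>
  define P where "P y = indicator (E \<inter> {y. norm y < R}) y * F y" for y
  define Q where "Q y = indicator (E \<inter> {y. R < norm y}) y * - F y" for y
  have [measurable]: "P \<in> borel_measurable borel" "Q \<in> borel_measurable borel"
    unfolding P_def Q_def by measurable
  \<comment> \<open>The pointwise gain on the ball |y| < R/2: there s \<le> 1/2, so both factors of
    the product are at least their values at s = 1/2, and the kernel is at least its value at
    distance 3R/2.\<close>
  define \<kappa> where "\<kappa> = R powr \<tau> * ((2 powr (- \<tau>) - 1) * (2 powr (N + \<tau> - 2 * \<alpha>) - 1)) * (3 / 2 * R) powr q"
  have EF: "indicator E y * F y = P y - Q y" for y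
  proof (cases "norm y" R rule: linorder_cases)
    case equal
    then show ?thesis by (simp add: P_def Q_def F_def)
  qed (simp_all add: P_def Q_def indicator_def)
  \<comment> \<open>The convention \<open>0 powr \<tau> = 0\<close> makes \<open>P\<close> negative
    at the origin, which is a null set.\<close>
  have P0: "P y \<ge> 0" if "y \<noteq> 0" for y
    using that powr_mono2'[of \<tau> "norm y" R] \<tau> by (simp add: P_def F_def indicator_def)
  have Q0: "Q y \<ge> 0" for y
    using powr_mono2'[of \<tau> R "norm y"] \<tau> R by (auto simp: Q_def F_def indicator_def mult_le_0_iff)
  have iK: "integrable lborel (\<lambda>y. indicator {y. \<epsilon> \<le> norm (x - y)} y * norm (x - y) powr q)"
    using has_bochner_integral_tail_kernel[OF \<alpha>, where 'a='a] \<epsilon>(1)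
    unfolding q_def N_def by (auto simp: has_bochner_integral_iff)
  have iT: "integrable lborel (\<lambda>y. indicator {y. \<epsilon> \<le> norm (x - y)} y * (norm y powr \<tau> * norm (x - y) powr q))"
    using integral_tail_power_kernel[OF \<alpha> \<tau>(1)] \<tau>(2) \<epsilon>(1)
    unfolding q_def N_def by auto
  have iF: "integrable lborel (\<lambda>y. indicator {y. \<epsilon> \<le> norm (x - y)} y * F y)"
    using Bochner_Integration.integrable_diff[OF iT integrable_mult_right[OF iK, of "R powr \<tau>"]]
    by (rule back_subst[of "integrable lborel"]) (auto simp: F_def algebra_simps)
  have iP: "integrable lborel P"
    by (rule Bochner_Integration.integrable_bound[OF iF]) (auto intro!: AE_I2 simp: P_def E_def indicator_def)
  have iQ: "integrable lborel Q"
    by (rule Bochner_Integration.integrable_bound[OF iF]) (auto intro!: AE_I2 simp: Q_def E_def indicator_def)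
  have [measurable]: "ball (0::'a) (R / 2) \<in> sets borel" by simp
  have \<kappa>0: "\<kappa> \<ge> 0"
    unfolding \<kappa>_def using \<tau> R by (auto intro!: mult_nonneg_nonneg ge_one_powr_ge_zero simp: N_def)
  have AE0: "AE y in lborel. (y::'a) \<noteq> 0" by (rule AE_lborel_singleton)
  have AEP: "AE y in lborel. 0 \<le> P y" using AE0 by eventually_elim (rule P0)
  have AEQ: "AE y in lborel. 0 \<le> Q y" by (simp add: Q0)
  let ?T = "\<lambda>y::'a. (R\<^sup>2 / (norm y)\<^sup>2) *\<^sub>R y"
  \<comment> \<open>The exterior integrand, pulled back by the inversion and weighted with its
    Jacobian, dominates the interior one with a surplus on the half ball.\<close>
  have key: "P y + \<kappa> * indicator (ball 0 (R / 2)) y \<le> Q (?T y) * (R / norm y) ^ (2 * DIM('a))"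
    if y: "y \<noteq> 0" for y
  proof (cases "y \<in> E \<and> norm y < R")
    case True
    define s where "s = norm y / R"
    have s: "0 < s" "s < 1" using True y R by (auto simp: s_def)
    have ny: "norm y = R * s" using R by (simp add: s_def)
    have nT: "norm (?T y) = R / s" using R y by (simp add: s_def power2_eq_square)
    have dT: "norm (x - ?T y) = norm (x - y) / s"
      using norm_diff_inversion[OF y, of x] R by (simp add: s_def R_def)
    \<comment> \<open>The inversion moves interior points farther from \<open>x\<close>, so T y
      survives the truncation whenever \<open>y\<close> does.\<close>
    have "norm (x - y) * s \<le> norm (x - y) * 1" using s by (intro mult_left_mono) auto
    then have "norm (x - y) \<le> norm (x - y) / s" using s by (simp add: field_simps)
    then have inE: "?T y \<in> E" using True dT by (simp add: E_def)
    have gtR: "R < norm (?T y)" using s R unfolding nT by (simp add: field_simps)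
    have QT: "Q (?T y) = - F (?T y)" using inE gtR by (simp only: Q_def) (simp add: indicator_def)
    have Rs: "R / norm y = 1 / s" by (simp add: s_def)
    have "Q (?T y) * (R / norm y) ^ (2 * DIM('a))
      = (R powr \<tau> - (R / s) powr \<tau>) * (norm (x - y) / s) powr q * (1 / s) ^ (2 * DIM('a))"
      unfolding QT F_def dT nT Rs by (simp add: algebra_simps)
    also have "(1 / s) ^ (2 * DIM('a)) = s powr (- 2 * N)"
      using s powr_realpow[of s "2 * DIM('a)"] by (simp add: power_one_over powr_minus field_simps N_def)
    also have "(R powr \<tau> - (R / s) powr \<tau>) * (norm (x - y) / s) powr q * s powr (- 2 * N)
      = R powr \<tau> * norm (x - y) powr q * ((1 - s powr (- \<tau>)) * s powr (2 * \<alpha> - N))"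
    proof -
      have e1: "s powr (- q) * s powr (- 2 * N) = s powr (2 * \<alpha> - N)"
        by (simp add: q_def flip: powr_add)
      have "(R / s) powr \<tau> = R powr \<tau> * s powr (- \<tau>)"
        using s R by (simp add: powr_divide powr_minus field_simps)
      moreover have "(norm (x - y) / s) powr q = norm (x - y) powr q * s powr (- q)"
        using s by (simp add: powr_divide powr_minus field_simps)
      ultimately have "(R powr \<tau> - (R / s) powr \<tau>) * (norm (x - y) / s) powr q * s powr (- 2 * N)
        = (R powr \<tau> - R powr \<tau> * s powr (- \<tau>)) * (norm (x - y) powr q * s powr (- q)) * s powr (- 2 * N)"
        by simp
      also have "\<dots> = R powr \<tau> * norm (x - y) powr q * ((1 - s powr (- \<tau>)) * (s powr (- q) * s powr (- 2 * N)))"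
        by (simp add: algebra_simps)
      finally show ?thesis unfolding e1 .
    qed
    \<comment> \<open>The first summand reproduces \<open>P\<close>; the product is the surplus,
      nonnegative because neither exponent is positive and s < 1.\<close>
    also have "(1 - s powr (- \<tau>)) * s powr (2 * \<alpha> - N)
        = (s powr \<tau> - 1) + (s powr \<tau> - 1) * (s powr (2 * \<alpha> - N - \<tau>) - 1)"
      by (simp add: algebra_simps flip: powr_add)
    finally have eq: "Q (?T y) * (R / norm y) ^ (2 * DIM('a))
      = P y + R powr \<tau> * norm (x - y) powr q * ((s powr \<tau> - 1) * (s powr (2 * \<alpha> - N - \<tau>) - 1))"
      using True R s by (simp add: P_def F_def ny powr_mult algebra_simps)
    have "\<kappa> * indicator (ball 0 (R / 2)) y
      \<le> R powr \<tau> * norm (x - y) powr q * ((s powr \<tau> - 1) * (s powr (2 * \<alpha> - N - \<tau>) - 1))"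
    proof (cases "norm y < R / 2")
      case small: True
      have s2: "s \<le> 1 / 2" using small R by (simp add: s_def field_simps)
      have a: "2 powr (- \<tau>) \<le> s powr \<tau>"
        using powr_mono2'[of \<tau> s "1 / 2"] s s2 \<tau> by (simp add: powr_divide powr_minus divide_simps)
      have b: "2 powr (N + \<tau> - 2 * \<alpha>) \<le> s powr (2 * \<alpha> - N - \<tau>)"
      proof -
        have half: "(1 / 2) powr (- e) = 2 powr e" for e :: real
          by (simp add: powr_divide powr_minus)
        have "(1 / 2) powr (- (N + \<tau> - 2 * \<alpha>)) \<le> s powr (- (N + \<tau> - 2 * \<alpha>))"
          using s s2 \<tau> by (intro powr_mono2') (auto simp: N_def)
        moreover have "2 * \<alpha> - N - \<tau> = - (N + \<tau> - 2 * \<alpha>)" by simp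
        ultimately show ?thesis by (simp only: half)
      qed
      have xy: "norm (x - y) \<le> 3 / 2 * R" "0 < norm (x - y)"
        using norm_triangle_ineq4[of x y] small True \<epsilon> by (auto simp: R_def E_def)
      have c: "(3 / 2 * R) powr q \<le> norm (x - y) powr q"
        using xy N \<alpha> by (intro powr_mono2') (auto simp: q_def)
      have a1: "1 \<le> 2 powr (- \<tau>)" and b1: "1 \<le> 2 powr (N + \<tau> - 2 * \<alpha>)"
        using \<tau> by (auto intro!: ge_one_powr_ge_zero simp: N_def)
      have "(2 powr (- \<tau>) - 1) * (2 powr (N + \<tau> - 2 * \<alpha>) - 1) \<le> (s powr \<tau> - 1) * (s powr (2 * \<alpha> - N - \<tau>) - 1)"
        using a b a1 b1 by (intro mult_mono) auto
      then have "(R powr \<tau> * (3 / 2 * R) powr q) * ((2 powr (- \<tau>) - 1) * (2 powr (N + \<tau> - 2 * \<alpha>) - 1))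
        \<le> (R powr \<tau> * norm (x - y) powr q) * ((s powr \<tau> - 1) * (s powr (2 * \<alpha> - N - \<tau>) - 1))"
        using c a1 b1 by (intro mult_mono[OF mult_left_mono[OF c]]) (simp_all add: zero_le_mult_iff)
      then show ?thesis using small by (simp add: \<kappa>_def mult.assoc mult.commute mult.left_commute)
    next
      case False
      have "1 \<le> s powr \<tau>" using powr_mono2'[of \<tau> s 1] s \<tau> by auto
      moreover have "1 \<le> s powr (2 * \<alpha> - N - \<tau>)"
        using powr_mono2'[of "2 * \<alpha> - N - \<tau>" s 1] s \<tau> by (auto simp: N_def)
      ultimately show ?thesis using False by auto
    qed
    then show ?thesis unfolding eq by simp
  next
    case False
    \<comment> \<open>Since \<epsilon> < R/2 the half ball is not cut by the truncation, so outside
      the first case the left side is 0.\<close>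
    have "y \<notin> ball 0 (R / 2)"
    proof
      assume "y \<in> ball 0 (R / 2)"
      then have small: "norm y < R / 2" by simp
      have "norm y < R" using small R by linarith
      moreover have "\<epsilon> < norm (x - y)"
        using small R norm_triangle_ineq2[of x y] unfolding R_def by linarith
      ultimately show False using False by (simp add: E_def)
    qed
    with False show ?thesis using Q0[of "?T y"] R by (auto simp: P_def)
  qed
  \<comment> \<open>The comparison is integrated in the extended nonnegative reals, where the
    inversion formula applies directly; integrability of \<open>P\<close> and \<open>Q\<close> then
    allows the return to real integrals.\<close>
  have "(\<integral>\<^sup>+y. ennreal (P y) \<partial>lborel) + ennreal (\<kappa> * (unit_ball_vol N * (R / 2) ^ DIM('a)))
    = (\<integral>\<^sup>+y. ennreal (P y) \<partial>lborel) + (\<integral>\<^sup>+y. ennreal \<kappa> * indicator (ball (0::'a) (R / 2)) y \<partial>lborel)"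
    using R \<kappa>0 by (simp add: nn_integral_cmult_indicator emeasure_ball N_def ennreal_mult')
  also have "\<dots> = (\<integral>\<^sup>+y. ennreal (P y) + ennreal \<kappa> * indicator (ball (0::'a) (R / 2)) y \<partial>lborel)"
    by (rule nn_integral_add[symmetric]) measurable
  also have "\<dots> \<le> (\<integral>\<^sup>+y. ennreal (Q (?T y)) * ennreal ((R / norm y) ^ (2 * DIM('a))) \<partial>lborel)"
  proof (rule nn_integral_mono_AE)
    show "AE y in lborel. ennreal (P y) + ennreal \<kappa> * indicator (ball (0::'a) (R / 2)) y
      \<le> ennreal (Q (?T y)) * ennreal ((R / norm y) ^ (2 * DIM('a)))"
      using AE0
    proof eventually_elim
      case (elim y)
      have "ennreal (P y) + ennreal \<kappa> * indicator (ball (0::'a) (R / 2)) y = ennreal (P y + \<kappa> * indicator (ball 0 (R / 2)) y)"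
        using P0[OF elim] \<kappa>0 by (auto simp: indicator_def)
      also have "\<dots> \<le> ennreal (Q (?T y) * (R / norm y) ^ (2 * DIM('a)))"
        by (rule ennreal_leI[OF key[OF elim]])
      finally show ?case using Q0[of "?T y"] by (simp add: ennreal_mult')
    qed
  qed
  also have "\<dots> = (\<integral>\<^sup>+y. ennreal (Q y) \<partial>lborel)"
    by (rule nn_integral_inversion) (use R in auto)
  finally have "ennreal (integral\<^sup>L lborel P) + ennreal (\<kappa> * (unit_ball_vol N * (R / 2) ^ DIM('a))) \<le> ennreal (integral\<^sup>L lborel Q)"
    by (simp only: nn_integral_eq_integral[OF iP AEP] nn_integral_eq_integral[OF iQ AEQ])
  moreover have "integral\<^sup>L lborel P \<ge> 0"
    by (rule integral_nonneg_AE[OF AEP])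
  moreover have "integral\<^sup>L lborel Q \<ge> 0"
    by (rule integral_nonneg_AE[OF AEQ])
  ultimately have PQ: "integral\<^sup>L lborel P + \<kappa> * (unit_ball_vol N * (R / 2) ^ DIM('a)) \<le> integral\<^sup>L lborel Q"
    using \<kappa>0 R by (simp add: N_def flip: ennreal_plus)
  have "(LINT y|lborel. indicator E y * F y) = integral\<^sup>L lborel P - integral\<^sup>L lborel Q"
    unfolding EF using iP iQ by (rule Bochner_Integration.integral_diff)
  also have "\<dots> \<le> - (\<kappa> * (unit_ball_vol N * (R / 2) ^ DIM('a)))" using PQ by simp
  also have "\<kappa> * (unit_ball_vol N * (R / 2) ^ DIM('a))
    = ((2 powr (- \<tau>) - 1) * (2 powr (N + \<tau> - 2 * \<alpha>) - 1) * (3 / 2) powr q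
        * unit_ball_vol N * (1 / 2) ^ DIM('a)) * (R powr \<tau> * R powr q * R powr N)"
    using R unfolding \<kappa>_def powr_mult by (simp add: power_divide powr_realpow N_def)
  also have "R powr \<tau> * R powr q * R powr N = R powr (\<tau> - 2 * \<alpha>)"
    by (simp add: q_def flip: powr_add)
  finally show ?thesis
    unfolding E_def F_def N_def q_def R_def superharmonicity_constant_def by simp
qed

section \<open>Touching from above\<close>

text \<open>The point \<open>x\<close> maximises u - M |y|^\<tau> - k |y - x0|^2 over a ball about
  \<open>x0\<close>; the penalty is strong enough to keep the maximum well inside. Re-expanding the
  penalty about \<open>x\<close> gives a square plus a term linear in x - y, whose oddness is
  exploited after integration. The last bound is the crude one, used far from
  \<open>x\<close>.\<close>

lemma touching_point:
  fixes u :: "'a::euclidean_space \<Rightarrow> real"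
  assumes cont: "continuous_on (UNIV - {0}) u" and "\<tau> < 0" "0 \<le> M" "0 < h" "0 \<le> C"
    and up: "\<And>y. 0 < norm y \<Longrightarrow> norm y < \<delta> \<Longrightarrow> u y \<le> (M + h) * norm y powr \<tau>"
    and far: "\<And>y. \<delta> \<le> norm y \<Longrightarrow> u y \<le> C"
    and x0: "0 < norm x0" "2 * norm x0 < \<delta>" "(M - h) * norm x0 powr \<tau> \<le> u x0"
  defines "k \<equiv> 32 * 2 powr (- \<tau>) * h * norm x0 powr (\<tau> - 2)"
  obtains x where "norm (x - x0) < norm x0 / 4"
    "\<And>y. norm (x - y) < norm x0 / 4 \<Longrightarrow>
      u y - u x \<le> M * (norm y powr \<tau> - norm x powr \<tau>) + k * ((norm (x - y))\<^sup>2 - 2 * ((x - y) \<bullet> (x - x0)))"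
    "\<And>y. y \<noteq> 0 \<Longrightarrow>
      u y - u x \<le> M * (norm y powr \<tau> - norm x powr \<tau>) + h * norm y powr \<tau> + (h * norm x0 powr \<tau> + C)"
proof -
  define R where "R = norm x0"
  have R: "R > 0" using x0 by (simp add: R_def)
  define F where "F y = u y - M * norm y powr \<tau> - k * (norm (y - x0))\<^sup>2" for y
  \<comment> \<open>Radius R/2 keeps the ball away from the origin, and inside |y| < \<delta>
    because 2R < \<delta>.\<close>
  let ?S = "cball x0 (R / 2)"
  have S: "R / 2 \<le> norm y" "norm y < \<delta>" if "y \<in> ?S" for y
    using that norm_triangle_ineq2[of x0 y] norm_triangle_ineq2[of y x0] x0 R
    by (auto simp: R_def dist_norm norm_minus_commute)
  have S0: "y \<noteq> 0" if "y \<in> ?S" for y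
    using S(1)[OF that] R by auto
  have "continuous_on ?S u"
    by (rule continuous_on_subset[OF cont]) (use S0 in blast)
  then have "continuous_on ?S F"
    unfolding F_def using S0 by (intro continuous_intros) auto
  then obtain x where x: "x \<in> ?S" "\<And>y. y \<in> ?S \<Longrightarrow> F y \<le> F x"
    using continuous_attains_sup[of ?S F] R by (auto simp: compact_cball)
  have k: "k \<ge> 0" using \<open>h > 0\<close> by (simp add: k_def)
  have Fx0: "- h * R powr \<tau> \<le> F x0" using x0 by (simp add: F_def R_def algebra_simps)
  then have Fx: "- h * R powr \<tau> \<le> F x" using x(2)[of x0] R by simp
  have near: "norm (x - x0) < R / 4"
  proof (rule ccontr)
    assume "\<not> norm (x - x0) < R / 4"
    then have "(R / 4)\<^sup>2 \<le> (norm (x - x0))\<^sup>2" using R by (intro power_mono) auto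
    then have "k * (R / 4)\<^sup>2 \<le> k * (norm (x - x0))\<^sup>2" using k by (rule mult_left_mono)
    \<comment> \<open>The factor 32 is 2 * 4^2: at distance R/4 the penalty is twice the largest
      possible excess 2^(-\<tau>) h R^\<tau> of \<open>u\<close> over M |y|^\<tau>. So
      \<open>F\<close> falls below -2^(-\<tau>) h R^\<tau>, which is less than its lower bound -h
      R^\<tau> at \<open>x0\<close>.\<close>
    moreover have "k * (R / 4)\<^sup>2 = 2 * 2 powr (- \<tau>) * h * R powr \<tau>"
      using R by (simp add: k_def R_def[symmetric] powr_diff power_divide)
    moreover have "h * norm x powr \<tau> \<le> h * (2 powr (- \<tau>) * R powr \<tau>)"
      using powr_mono2'[of \<tau> "R / 2" "norm x"] S(1)[OF x(1)] R \<open>\<tau> < 0\<close> \<open>h > 0\<close>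
      by (intro mult_left_mono) (auto simp: powr_divide powr_minus field_simps)
    moreover have "u x \<le> M * norm x powr \<tau> + h * norm x powr \<tau>"
      using up[of x] S[OF x(1)] S0[OF x(1)] by (auto simp: algebra_simps)
    ultimately have "F x \<le> - (2 powr (- \<tau>) * h * R powr \<tau>)"
      unfolding F_def by (simp add: algebra_simps)
    moreover have "1 * (h * R powr \<tau>) < 2 powr (- \<tau>) * (h * R powr \<tau>)"
      using \<open>\<tau> < 0\<close> \<open>h > 0\<close> R by (intro mult_strict_right_mono) auto
    ultimately show False using Fx by simp
  qed
  have ux: "M * norm x powr \<tau> - h * R powr \<tau> \<le> u x"
    using Fx k by (simp add: F_def) (smt (verit) mult_nonneg_nonneg zero_le_power2)
  show ?thesis
  proof (rule that)
    show "norm (x - x0) < norm x0 / 4" using near by (simp add: R_def)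
  next
    fix y assume y: "norm (x - y) < norm x0 / 4"
    have "norm (y - x0) \<le> norm (x - y) + norm (x - x0)"
      using norm_triangle_ineq[of "y - x" "x - x0"] by (simp add: norm_minus_commute)
    then have "y \<in> ?S" using y near by (simp add: R_def dist_norm norm_minus_commute)
    then have "F y \<le> F x" by (rule x(2))
    moreover have "(norm (y - x0))\<^sup>2 = (norm (x - x0))\<^sup>2 + ((norm (x - y))\<^sup>2 - 2 * ((x - y) \<bullet> (x - x0)))"
      by (simp add: power2_norm_eq_inner inner_diff inner_commute algebra_simps)
    ultimately show "u y - u x \<le> M * (norm y powr \<tau> - norm x powr \<tau>) + k * ((norm (x - y))\<^sup>2 - 2 * ((x - y) \<bullet> (x - x0)))"
      unfolding F_def by (simp add: algebra_simps)
  next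
    fix y :: 'a assume y: "y \<noteq> 0"
    have nn: "0 \<le> M * norm y powr \<tau>" "0 \<le> h * norm y powr \<tau>"
      using \<open>0 \<le> M\<close> \<open>0 < h\<close> by auto
    have "u y \<le> M * norm y powr \<tau> + h * norm y powr \<tau> + C"
      using up[of y] far[of y] y \<open>0 \<le> C\<close> nn by (cases "norm y < \<delta>") (auto simp: algebra_simps)
    then show "u y - u x \<le> M * (norm y powr \<tau> - norm x powr \<tau>) + h * norm y powr \<tau> + (h * norm x0 powr \<tau> + C)"
      using ux by (simp add: R_def algebra_simps)
  qed
qed

text \<open>This disposes of the linear term in the touching inequality. Against the kernel that
  term has size |x - y|^(1 - N - 2\<alpha>), not absolutely integrable near \<open>x\<close> when
  \<alpha> \<ge> 1/2, so cancellation over symmetric truncations is essential.\<close>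

lemma integral_odd_reflect_eq_0:
  fixes \<phi> :: "'a::euclidean_space \<Rightarrow> real"
  assumes [measurable]: "\<phi> \<in> borel_measurable borel" and odd: "\<And>y. \<phi> (- y) = - \<phi> y"
  shows "(LINT y|lborel. \<phi> (x - y)) = 0"
proof -
  have *: "(LINT y|lborel. \<phi> (z - y)) = (LINT y|lborel. \<phi> y)" for z
    by (subst (2) lborel_distr_reflect[of z, symmetric]) (simp add: integral_distr)
  have "(LINT y|lborel. \<phi> y) = (LINT y|lborel. - \<phi> y)"
    using *[of 0] by (simp add: odd)
  then show ?thesis using *[of x] by simp
qed

text \<open>Within distance \<rho> of \<open>x\<close> the quadratic term is integrable against the
  kernel because 2 - 2\<alpha> > 0, and the linear one cancels; beyond \<rho> the tail estimates
  apply. The bound on the error is uniform in \<epsilon>, and \<open>B\<close> depends only on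
  \<alpha>, \<tau> and the dimension.\<close>

lemma truncated_integral_touching_le:
  assumes \<alpha>: "0 < \<alpha>" "\<alpha> < 1" and \<tau>: "- real DIM('a) < \<tau>" "\<tau> \<le> 0"
  shows "\<exists>B\<ge>0. \<forall>(u::'a::euclidean_space \<Rightarrow> real) x v \<rho> \<epsilon> M k h D.
    0 < \<epsilon> \<longrightarrow> \<epsilon> < \<rho> \<longrightarrow> 0 \<le> k \<longrightarrow> 0 \<le> h \<longrightarrow> 0 \<le> D \<longrightarrow>
    (\<forall>y. norm (x - y) < \<rho> \<longrightarrow>
      u y - u x \<le> M * (norm y powr \<tau> - norm x powr \<tau>) + k * ((norm (x - y))\<^sup>2 - 2 * ((x - y) \<bullet> v))) \<longrightarrow>
    (\<forall>y. y \<noteq> 0 \<longrightarrow> u y - u x \<le> M * (norm y powr \<tau> - norm x powr \<tau>) + h * norm y powr \<tau> + D) \<longrightarrow>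
    integrable lborel (\<lambda>y. indicator {y. \<epsilon> < norm (x - y)} y * ((u y - u x) * norm (x - y) powr (- (real DIM('a) + 2 * \<alpha>)))) \<longrightarrow>
    (LINT y|lborel. indicator {y. \<epsilon> < norm (x - y)} y * ((u y - u x) * norm (x - y) powr (- (real DIM('a) + 2 * \<alpha>))))
    \<le> M * (LINT y|lborel. indicator {y. \<epsilon> < norm (x - y)} y *
          ((norm y powr \<tau> - norm x powr \<tau>) * norm (x - y) powr (- (real DIM('a) + 2 * \<alpha>))))
      + B * (k * \<rho> powr (2 - 2 * \<alpha>) + h * \<rho> powr (\<tau> - 2 * \<alpha>) + D * \<rho> powr (- 2 * \<alpha>))"
proof -
  define q where "q = - (real DIM('a) + 2 * \<alpha>)"
  obtain C1 where C1: "C1 \<ge> 0" "\<And>x r. r > 0 \<Longrightarrow> has_bochner_integral lborel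
      (\<lambda>y::'a. indicator (ball x r) y * norm (x - y) powr (2 + q)) (C1 * r powr (2 - 2 * \<alpha>))"
    using has_bochner_integral_ball_powr[of "2 + q", where 'a='a] \<alpha> by (auto simp: q_def)
  obtain C2 where C2: "C2 \<ge> 0" "\<And>x r. r > 0 \<Longrightarrow>
    integrable lborel (\<lambda>y::'a. indicator {y. r \<le> norm (x - y)} y * (norm y powr \<tau> * norm (x - y) powr q))"
    "\<And>x r. r > 0 \<Longrightarrow> (LINT y|lborel. indicator {y. r \<le> norm (x - y)} y * (norm (y::'a) powr \<tau> * norm (x - y) powr q))
      \<le> C2 * r powr (\<tau> - 2 * \<alpha>)"
    using integral_tail_power_kernel[OF \<alpha>(1) \<tau>] by (auto simp: q_def)
  obtain C3 where C3: "C3 \<ge> 0" "\<And>x r. r > 0 \<Longrightarrow> has_bochner_integral lborel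
      (\<lambda>y::'a. indicator {y. r \<le> norm (x - y)} y * norm (x - y) powr q) (C3 * r powr (- 2 * \<alpha>))"
    using has_bochner_integral_tail_kernel[OF \<alpha>(1), where 'a = 'a] by (auto simp: q_def)
  define B where "B = C1 + C2 + C3"
  have *: "(LINT y|lborel. indicator {y. \<epsilon> < norm (x - y)} y * ((u y - u x) * norm (x - y) powr q))
    \<le> M * (LINT y|lborel. indicator {y. \<epsilon> < norm (x - y)} y * ((norm y powr \<tau> - norm x powr \<tau>) * norm (x - y) powr q))
      + B * (k * \<rho> powr (2 - 2 * \<alpha>) + h * \<rho> powr (\<tau> - 2 * \<alpha>) + D * \<rho> powr (- 2 * \<alpha>))"
    if \<epsilon>: "0 < \<epsilon>" "\<epsilon> < \<rho>" and nn: "0 \<le> k" "0 \<le> h" "0 \<le> D"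
    and near: "\<And>y. norm (x - y) < \<rho> \<Longrightarrow>
      u y - u x \<le> M * (norm y powr \<tau> - norm x powr \<tau>) + k * ((norm (x - y))\<^sup>2 - 2 * ((x - y) \<bullet> v))"
    and far: "\<And>y. y \<noteq> 0 \<Longrightarrow> u y - u x \<le> M * (norm y powr \<tau> - norm x powr \<tau>) + h * norm y powr \<tau> + D"
    and int: "integrable lborel (\<lambda>y. indicator {y. \<epsilon> < norm (x - y)} y * ((u y - u x) * norm (x - y) powr q))"
    for u :: "'a \<Rightarrow> real" and x v \<rho> \<epsilon> M k h D
  proof -
    let ?K = "\<lambda>y. norm (x - y) powr q"
    let ?E = "{y. \<epsilon> < norm (x - y)}"
    have \<rho>: "\<rho> > 0" using \<epsilon> by simp
    let ?G1 = "\<lambda>y. indicator ?E y * ((norm y powr \<tau> - norm x powr \<tau>) * ?K y)"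
    have "integrable lborel (\<lambda>y. indicator {y. \<epsilon> \<le> norm (x - y)} y * (norm y powr \<tau> * ?K y)
       - norm x powr \<tau> * (indicator {y. \<epsilon> \<le> norm (x - y)} y * ?K y))"
      using C2(2)[OF \<epsilon>(1), of x] C3(2)[OF \<epsilon>(1), of x]
      by (intro Bochner_Integration.integrable_diff integrable_mult_right) (auto simp: has_bochner_integral_iff)
    then have i1: "integrable lborel ?G1"
      by (rule Bochner_Integration.integrable_bound) (auto intro!: AE_I2 simp: indicator_def algebra_simps)
    \<comment> \<open>The quadratic term is integrated over the whole ball rather than the annulus,
      which only increases it and removes \<epsilon> from its integral.\<close>
    let ?G2 = "\<lambda>y. indicator (ball x \<rho>) y * norm (x - y) powr (2 + q)"
    have i2: "integrable lborel ?G2" "integral\<^sup>L lborel ?G2 = C1 * \<rho> powr (2 - 2 * \<alpha>)"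
      using C1(2)[OF \<rho>, of x] by (auto simp: has_bochner_integral_iff)
    \<comment> \<open>The linear term must stay on the annulus \<epsilon> < |w| < \<rho>: it is
      integrable there, and the annulus is symmetric, so \<open>?\<phi>\<close> is odd.\<close>
    let ?\<phi> = "\<lambda>w. indicator {w. \<epsilon> < norm w \<and> norm w < \<rho>} w * ((w \<bullet> v) * norm w powr q)"
    let ?G3 = "\<lambda>y. ?\<phi> (x - y)"
    have i3: "integrable lborel ?G3"
    proof (rule Bochner_Integration.integrable_bound)
      show "integrable lborel (\<lambda>y. (\<rho> * norm v) * (indicator {y. \<epsilon> \<le> norm (x - y)} y * ?K y))"
        using C3(2)[OF \<epsilon>(1), of x] by (intro integrable_mult_right) (auto simp: has_bochner_integral_iff)
      show "?G3 \<in> borel_measurable lborel" by measurable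
      show "AE y in lborel. norm (?G3 y) \<le> norm ((\<rho> * norm v) * (indicator {y. \<epsilon> \<le> norm (x - y)} y * ?K y))"
      proof (rule AE_I2)
        fix y
        have "\<bar>(x - y) \<bullet> v\<bar> * ?K y \<le> (\<rho> * norm v) * ?K y" if "norm (x - y) < \<rho>"
          using that Cauchy_Schwarz_ineq2[of "x - y" v] mult_right_mono[of "norm (x - y)" \<rho> "norm v"]
          by (intro mult_right_mono) auto
        then show "norm (?G3 y) \<le> norm ((\<rho> * norm v) * (indicator {y. \<epsilon> \<le> norm (x - y)} y * ?K y))"
          using \<rho> by (auto simp: indicator_def abs_mult)
      qed
    qed
    have z3: "integral\<^sup>L lborel ?G3 = 0"
      by (rule integral_odd_reflect_eq_0[of ?\<phi>]) (measurable, simp add: indicator_def)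
    let ?G4 = "\<lambda>y. indicator {y. \<rho> \<le> norm (x - y)} y * (norm y powr \<tau> * ?K y)"
    note i4 = C2(2)[OF \<rho>, of x] C2(3)[OF \<rho>, of x]
    let ?G5 = "\<lambda>y. indicator {y. \<rho> \<le> norm (x - y)} y * ?K y"
    have i5: "integrable lborel ?G5" "integral\<^sup>L lborel ?G5 = C3 * \<rho> powr (- 2 * \<alpha>)"
      using C3(2)[OF \<rho>, of x] by (auto simp: has_bochner_integral_iff)
    let ?G = "\<lambda>y. M * ?G1 y + k * ?G2 y + (- 2 * k) * ?G3 y + h * ?G4 y + D * ?G5 y"
    have iG: "integrable lborel ?G"
      by (intro Bochner_Integration.integrable_add integrable_mult_right i1 i2 i3 i4 i5)
    have "AE y in lborel. (y::'a) \<noteq> 0" by (rule AE_lborel_singleton)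
    then have "AE y in lborel. indicator ?E y * ((u y - u x) * ?K y) \<le> ?G y"
    proof eventually_elim
      case (elim y)
      show ?case
      proof (cases "\<epsilon> < norm (x - y)")
        case True
        show ?thesis
        proof (cases "norm (x - y) < \<rho>")
          case near': True
          have "norm (x - y) powr (2 + q) = (norm (x - y))\<^sup>2 * ?K y"
            using True \<epsilon> by (simp add: powr_add)
          moreover have "(u y - u x) * ?K y \<le> (M * (norm y powr \<tau> - norm x powr \<tau>) + k * ((norm (x - y))\<^sup>2 - 2 * ((x - y) \<bullet> v))) * ?K y"
            by (intro mult_right_mono near near') auto
          ultimately show ?thesis using True near' by (simp add: indicator_def dist_norm algebra_simps)
        next
          case False
          have "(u y - u x) * ?K y \<le> (M * (norm y powr \<tau> - norm x powr \<tau>) + h * norm y powr \<tau> + D) * ?K y"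
            by (intro mult_right_mono far elim) auto
          then show ?thesis using True False by (simp add: indicator_def dist_norm algebra_simps)
        qed
      next
        case False
        then show ?thesis using nn \<epsilon> by (auto simp: indicator_def)
      qed
    qed
    then have "(LINT y|lborel. indicator ?E y * ((u y - u x) * ?K y)) \<le> integral\<^sup>L lborel ?G"
      by (intro integral_mono_AE int iG)
    also have "\<dots> = M * integral\<^sup>L lborel ?G1 + k * integral\<^sup>L lborel ?G2 + (- 2 * k) * integral\<^sup>L lborel ?G3
        + h * integral\<^sup>L lborel ?G4 + D * integral\<^sup>L lborel ?G5"
      using i1 i2(1) i3 i4(1) i5(1) by (simp del: integral_mult_right_zero add: integral_mult_right)
    also have "\<dots> \<le> M * integral\<^sup>L lborel ?G1 + k * (C1 * \<rho> powr (2 - 2 * \<alpha>))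
        + h * (C2 * \<rho> powr (\<tau> - 2 * \<alpha>)) + D * (C3 * \<rho> powr (- 2 * \<alpha>))"
      using mult_left_mono[OF i4(2) nn(2)] by (simp add: i2 z3 i5)
    also have "\<dots> \<le> M * integral\<^sup>L lborel ?G1 + k * (B * \<rho> powr (2 - 2 * \<alpha>))
        + h * (B * \<rho> powr (\<tau> - 2 * \<alpha>)) + D * (B * \<rho> powr (- 2 * \<alpha>))"
      using C1(1) C2(1) C3(1) by (intro add_mono mult_left_mono mult_right_mono nn order_refl) (auto simp: B_def)
    finally show ?thesis by (simp add: algebra_simps)
  qed
  show ?thesis
  proof (intro exI[of _ B] conjI allI impI)
    show "0 \<le> B" using C1(1) C2(1) C3(1) by (simp add: B_def)
  qed (rule *[unfolded q_def]; blast)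
qed

section \<open>The fractional Laplacian at a touching point\<close>

lemma frac_kernel_eq:
  "frac_kernel \<alpha> u x y = - ((u y - u x) * norm (x - y) powr (- (real CARD('n) + 2 * \<alpha>)))"
  for x :: "real^'n"
  unfolding frac_kernel_def powr_minus_divide by (simp add: minus_divide_left)

lemma frac_trunc_eq:
  fixes x :: "real^'n"
  shows "frac_trunc \<alpha> u x \<epsilon> = - (LINT y|lborel. indicator {y. \<epsilon> < norm (x - y)} y *
    ((u y - u x) * norm (x - y) powr (- (real CARD('n) + 2 * \<alpha>))))"
  by (simp add: frac_trunc_def set_lebesgue_integral_def frac_kernel_eq)

lemma set_integrable_frac_kernel_iff:
  fixes x :: "real^'n"
  shows "set_integrable lborel {y. \<epsilon> < norm (x - y)} (frac_kernel \<alpha> u x) \<longleftrightarrow>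
    integrable lborel (\<lambda>y. indicator {y. \<epsilon> < norm (x - y)} y *
      ((u y - u x) * norm (x - y) powr (- (real CARD('n) + 2 * \<alpha>))))"
  by (simp add: set_integrable_def frac_kernel_eq[abs_def])

text \<open>Touching at scale R = |x0| and integrating with \<rho> = R/4 bounds all truncations with
  \<epsilon> < R/4 by one quantity, which passes to the limit. The alternative on \<open>M\<close>
  is what lets the contribution of the power be discarded or estimated by superharmonicity.
  \<open>B\<close> is chosen before \<open>u\<close> and \<open>h\<close>, so \<open>h\<close> can
  later be taken small relative to it.\<close>

lemma frac_laplacian_at_touching_point:
  assumes \<alpha>: "0 < \<alpha>" "\<alpha> < 1" and \<tau>: "- real CARD('n) < \<tau>" "\<tau> < 0"
  shows "\<exists>B\<ge>0. \<forall>(u::real^'n \<Rightarrow> real) \<delta> C M h x0.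
    continuous_on (UNIV - {0}) u \<longrightarrow> 0 \<le> M \<longrightarrow> 0 < h \<longrightarrow> 0 \<le> C \<longrightarrow>
    M = 0 \<or> 2 * \<alpha> - real CARD('n) \<le> \<tau> \<longrightarrow>
    (\<forall>y. 0 < norm y \<longrightarrow> norm y < \<delta> \<longrightarrow> u y \<le> (M + h) * norm y powr \<tau>) \<longrightarrow>
    (\<forall>y. \<delta> \<le> norm y \<longrightarrow> u y \<le> C) \<longrightarrow>
    (\<forall>x. 0 < norm x \<longrightarrow> norm x < \<delta> \<longrightarrow> frac_laplacian_exists \<alpha> u x) \<longrightarrow>
    0 < norm x0 \<longrightarrow> 2 * norm x0 < \<delta> \<longrightarrow> (M - h) * norm x0 powr \<tau> \<le> u x0 \<longrightarrow>
    (\<exists>x. 3 / 4 * norm x0 \<le> norm x \<and> norm x \<le> 5 / 4 * norm x0 \<and>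
      - frac_laplacian \<alpha> u x \<le> - M * superharmonicity_constant CARD('n) \<alpha> \<tau> * norm x powr (\<tau> - 2 * \<alpha>)
        + B * (h * norm x0 powr (\<tau> - 2 * \<alpha>) + C * norm x0 powr (- 2 * \<alpha>)))"
proof -
  define q where "q = - (real CARD('n) + 2 * \<alpha>)"
  define \<kappa> where "\<kappa> = superharmonicity_constant CARD('n) \<alpha> \<tau>"
  obtain B where B: "B \<ge> 0" "\<And>(u::real^'n \<Rightarrow> real) x v \<rho> \<epsilon> M k h D.
    0 < \<epsilon> \<Longrightarrow> \<epsilon> < \<rho> \<Longrightarrow> 0 \<le> k \<Longrightarrow> 0 \<le> h \<Longrightarrow> 0 \<le> D \<Longrightarrow>
    (\<And>y. norm (x - y) < \<rho> \<Longrightarrow>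
      u y - u x \<le> M * (norm y powr \<tau> - norm x powr \<tau>) + k * ((norm (x - y))\<^sup>2 - 2 * ((x - y) \<bullet> v))) \<Longrightarrow>
    (\<And>y. y \<noteq> 0 \<Longrightarrow> u y - u x \<le> M * (norm y powr \<tau> - norm x powr \<tau>) + h * norm y powr \<tau> + D) \<Longrightarrow>
    integrable lborel (\<lambda>y. indicator {y. \<epsilon> < norm (x - y)} y * ((u y - u x) * norm (x - y) powr q)) \<Longrightarrow>
    (LINT y|lborel. indicator {y. \<epsilon> < norm (x - y)} y * ((u y - u x) * norm (x - y) powr q))
    \<le> M * (LINT y|lborel. indicator {y. \<epsilon> < norm (x - y)} y * ((norm y powr \<tau> - norm x powr \<tau>) * norm (x - y) powr q))
      + B * (k * \<rho> powr (2 - 2 * \<alpha>) + h * \<rho> powr (\<tau> - 2 * \<alpha>) + D * \<rho> powr (- 2 * \<alpha>))"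
    using truncated_integral_touching_le[of \<alpha> \<tau>, where 'a = "real^'n"] \<alpha> \<tau> unfolding q_def by force
  \<comment> \<open>The powers of 1/4 come from \<rho> = R/4, the factor 32 * 2^(-\<tau>) from the
    coefficient \<open>k\<close> of the penalty.\<close>
  define B' where "B' = B * (32 * 2 powr (- \<tau>) * (1 / 4) powr (2 - 2 * \<alpha>) + (1 / 4) powr (\<tau> - 2 * \<alpha>) + (1 / 4) powr (- 2 * \<alpha>))"
  have *: "\<exists>x. 3 / 4 * norm x0 \<le> norm x \<and> norm x \<le> 5 / 4 * norm x0 \<and>
      - frac_laplacian \<alpha> u x \<le> - M * \<kappa> * norm x powr (\<tau> - 2 * \<alpha>)
        + B' * (h * norm x0 powr (\<tau> - 2 * \<alpha>) + C * norm x0 powr (- 2 * \<alpha>))"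
    if cont: "continuous_on (UNIV - {0}) u" and nn: "0 \<le> M" "0 < h" "0 \<le> C"
      and M: "M = 0 \<or> 2 * \<alpha> - real CARD('n) \<le> \<tau>"
      and up: "\<And>y. 0 < norm y \<Longrightarrow> norm y < \<delta> \<Longrightarrow> u y \<le> (M + h) * norm y powr \<tau>"
      and far: "\<And>y. \<delta> \<le> norm y \<Longrightarrow> u y \<le> C"
      and ex: "\<And>x. 0 < norm x \<Longrightarrow> norm x < \<delta> \<Longrightarrow> frac_laplacian_exists \<alpha> u x"
      and x0: "0 < norm x0" "2 * norm x0 < \<delta>" "(M - h) * norm x0 powr \<tau> \<le> u x0"
    for u :: "real^'n \<Rightarrow> real" and \<delta> C M h x0
  proof -
    define R where "R = norm x0"
    define k where "k = 32 * 2 powr (- \<tau>) * h * R powr (\<tau> - 2)"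
    have R: "R > 0" using x0 by (simp add: R_def)
    obtain x where x: "norm (x - x0) < R / 4"
      and near_x: "\<And>y. norm (x - y) < R / 4 \<Longrightarrow>
        u y - u x \<le> M * (norm y powr \<tau> - norm x powr \<tau>) + k * ((norm (x - y))\<^sup>2 - 2 * ((x - y) \<bullet> (x - x0)))"
      and far_x: "\<And>y. y \<noteq> 0 \<Longrightarrow>
        u y - u x \<le> M * (norm y powr \<tau> - norm x powr \<tau>) + h * norm y powr \<tau> + (h * R powr \<tau> + C)"
      using touching_point[OF cont \<tau>(2) nn up far x0] unfolding R_def k_def by metis
    have nx: "3 / 4 * R \<le> norm x" "norm x \<le> 5 / 4 * R"
      using x norm_triangle_ineq2[of x0 x] norm_triangle_ineq2[of x x0]
      by (auto simp: R_def norm_minus_commute)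
    have exx: "frac_laplacian_exists \<alpha> u x"
    proof (rule ex)
      show "0 < norm x" using nx R by linarith
      show "norm x < \<delta>" using nx R x0(2) unfolding R_def by linarith
    qed
    then obtain L where L: "(frac_trunc \<alpha> u x \<longlongrightarrow> L) (at_right 0)"
      by (auto simp: frac_laplacian_exists_def)
    then have L_eq: "frac_laplacian \<alpha> u x = L"
      unfolding frac_laplacian_def by (intro tendsto_Lim) auto
    let ?U = "- M * \<kappa> * norm x powr (\<tau> - 2 * \<alpha>) + B' * (h * R powr (\<tau> - 2 * \<alpha>) + C * R powr (- 2 * \<alpha>))"
    have "- ?U \<le> frac_trunc \<alpha> u x \<epsilon>" if \<epsilon>: "0 < \<epsilon>" "\<epsilon> < R / 4" for \<epsilon>
    proof -
      have "integrable lborel (\<lambda>y. indicator {y. \<epsilon> < norm (x - y)} y * ((u y - u x) * norm (x - y) powr q))"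
        using exx \<epsilon>(1) unfolding q_def by (simp add: frac_laplacian_exists_def set_integrable_frac_kernel_iff)
      then have "- frac_trunc \<alpha> u x \<epsilon>
        \<le> M * (LINT y|lborel. indicator {y. \<epsilon> < norm (x - y)} y * ((norm y powr \<tau> - norm x powr \<tau>) * norm (x - y) powr q))
        + B * (k * (R / 4) powr (2 - 2 * \<alpha>) + h * (R / 4) powr (\<tau> - 2 * \<alpha>) + (h * R powr \<tau> + C) * (R / 4) powr (- 2 * \<alpha>))"
        unfolding frac_trunc_eq minus_minus q_def[symmetric]
        using nn \<epsilon> by (intro B(2)[OF _ _ _ _ _ near_x far_x]) (auto simp: k_def)
      also have "M * (LINT y|lborel. indicator {y. \<epsilon> < norm (x - y)} y * ((norm y powr \<tau> - norm x powr \<tau>) * norm (x - y) powr q))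
        \<le> M * (- \<kappa> * norm x powr (\<tau> - 2 * \<alpha>))"
      \<comment> \<open>The superharmonicity estimate asks for \<epsilon> < |x|/2, which follows
        from \<epsilon> < R/4 and |x| \<ge> 3R/4.\<close>
      proof (cases "M = 0")
        case False
        then show ?thesis
          using truncated_integral_power_le[of \<alpha> \<tau> \<epsilon> x] \<alpha> \<tau> M \<epsilon> nx nn(1)
          by (intro mult_left_mono) (auto simp: \<kappa>_def q_def)
      qed simp
      also have "B * (k * (R / 4) powr (2 - 2 * \<alpha>) + h * (R / 4) powr (\<tau> - 2 * \<alpha>) + (h * R powr \<tau> + C) * (R / 4) powr (- 2 * \<alpha>))
        \<le> B' * (h * R powr (\<tau> - 2 * \<alpha>) + C * R powr (- 2 * \<alpha>))"
      proof -
        have sc: "(R / 4) powr s = R powr s * (1 / 4) powr s" for s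
          using R by (simp flip: powr_mult)
        have e: "R powr (\<tau> - 2) * R powr (2 - 2 * \<alpha>) = R powr (\<tau> - 2 * \<alpha>)"
          "R powr \<tau> * R powr (- 2 * \<alpha>) = R powr (\<tau> - 2 * \<alpha>)"
          by (simp_all flip: powr_add)
        define b1 where "b1 = 32 * 2 powr (- \<tau>) * (1 / 4) powr (2 - 2 * \<alpha>)"
        define b2 where "b2 = (1 / 4) powr (\<tau> - 2 * \<alpha>)"
        define b3 where "b3 = (1 / 4) powr (- 2 * \<alpha>)"
        have b: "b1 \<ge> 0" "b2 \<ge> 0" "b3 \<ge> 0" by (auto simp: b1_def b2_def b3_def)
        have "k * (R / 4) powr (2 - 2 * \<alpha>) + h * (R / 4) powr (\<tau> - 2 * \<alpha>) + (h * R powr \<tau> + C) * (R / 4) powr (- 2 * \<alpha>)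
          = b1 * h * (R powr (\<tau> - 2) * R powr (2 - 2 * \<alpha>)) + b2 * h * R powr (\<tau> - 2 * \<alpha>)
            + b3 * (h * (R powr \<tau> * R powr (- 2 * \<alpha>)) + C * R powr (- 2 * \<alpha>))"
          unfolding sc k_def b1_def b2_def b3_def by (simp add: algebra_simps)
        also have "\<dots> = (b1 + b2 + b3) * (h * R powr (\<tau> - 2 * \<alpha>)) + b3 * (C * R powr (- 2 * \<alpha>))"
          unfolding e by (simp add: algebra_simps)
        also have "\<dots> \<le> (b1 + b2 + b3) * (h * R powr (\<tau> - 2 * \<alpha>)) + (b1 + b2 + b3) * (C * R powr (- 2 * \<alpha>))"
          using b nn by (intro add_mono mult_right_mono) auto
        finally have le: "k * (R / 4) powr (2 - 2 * \<alpha>) + h * (R / 4) powr (\<tau> - 2 * \<alpha>) + (h * R powr \<tau> + C) * (R / 4) powr (- 2 * \<alpha>)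
          \<le> (b1 + b2 + b3) * (h * R powr (\<tau> - 2 * \<alpha>) + C * R powr (- 2 * \<alpha>))"
          by (simp only: distrib_left)
        show ?thesis
          using mult_left_mono[OF le B(1)]
          unfolding B'_def b1_def[symmetric] b2_def[symmetric] b3_def[symmetric] by (simp only: mult.assoc)
      qed
      finally show ?thesis by simp
    qed
    then have "eventually (\<lambda>\<epsilon>. - ?U \<le> frac_trunc \<alpha> u x \<epsilon>) (at_right 0)"
      using R by (auto simp: eventually_at_right_field intro!: exI[of _ "R / 4"])
    then have "- ?U \<le> L"
      using L by (intro tendsto_lowerbound) auto
    then show ?thesis using nx L_eq unfolding R_def by (intro exI[of _ x]) auto
  qed
  show ?thesis
  proof (intro exI[of _ B'] conjI allI impI)
    show "0 \<le> B'" using B(1) by (simp add: B'_def)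
  qed (rule *[unfolded \<kappa>_def]; blast)
qed

section \<open>Nonexistence of singular solutions\<close>

lemma singular_solution_bounded_above_off_0:
  fixes u :: "real^'n \<Rightarrow> real"
  assumes "singular_solution \<alpha> p \<Omega> u" "bounded \<Omega>" "\<delta> > 0"
  obtains C where "C \<ge> 0" "\<And>y. \<delta> \<le> norm y \<Longrightarrow> u y \<le> C"
proof -
  obtain b where b: "\<And>y. y \<in> \<Omega> \<Longrightarrow> norm y \<le> b"
    using \<open>bounded \<Omega>\<close> by (auto simp: bounded_iff)
  have cont: "continuous_on (UNIV - {0}) u" and zero: "\<And>y. y \<notin> \<Omega> \<Longrightarrow> u y = 0"
    using assms(1) by (auto simp: singular_solution_def)
  have "continuous_on (cball 0 b - ball 0 \<delta>) u"
    by (rule continuous_on_subset[OF cont]) (use \<open>\<delta> > 0\<close> in auto)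
  moreover have "compact (cball (0::real^'n) b - ball 0 \<delta>)"
    by (intro compact_diff) auto
  ultimately have "bounded (u ` (cball 0 b - ball 0 \<delta>))"
    by (intro compact_imp_bounded compact_continuous_image)
  then obtain C where C: "\<forall>z \<in> u ` (cball 0 b - ball 0 \<delta>). norm z \<le> C"
    unfolding bounded_iff by blast
  have "u y \<le> max C 0" if "\<delta> \<le> norm y" for y
  proof (cases "y \<in> \<Omega>")
    case True
    then have "y \<in> cball 0 b - ball 0 \<delta>" using b that by auto
    then have "norm (u y) \<le> C" using C by blast
    then show ?thesis by auto
  qed (simp add: zero)
  then show ?thesis by (intro that[of "max C 0"]) auto
qed

theorem mainTheorem4:
  fixes \<alpha> p \<tau> :: real and \<Omega> :: "(real^'n) set"
  assumes "2 \<le> CARD('n)"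
    and "0 < \<alpha>" and "\<alpha> < 1"
    and "open \<Omega>" and "connected \<Omega>" and "bounded \<Omega>" and "smooth_boundary \<Omega>"
    and "0 \<in> \<Omega>"
    and "real CARD('n) / (real CARD('n) - 2 * \<alpha>) \<le> p"
    and "- real CARD('n) < \<tau>" and "\<tau> < 0"
  shows "\<not> (\<exists>u. singular_solution \<alpha> p \<Omega> u \<and>
      0 < Liminf (at 0) (\<lambda>x. ereal (u x * norm x powr (- \<tau>))) \<and>
      Liminf (at 0) (\<lambda>x. ereal (u x * norm x powr (- \<tau>)))
        \<le> Limsup (at 0) (\<lambda>x. ereal (u x * norm x powr (- \<tau>))) \<and>
      Limsup (at 0) (\<lambda>x. ereal (u x * norm x powr (- \<tau>))) < \<infinity>)"
proof
  define N where "N = real CARD('n)"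
  have N: "2 * \<alpha> < N" "2 \<le> N" "N / (N - 2 * \<alpha>) \<le> p" "- N < \<tau>"
    using assms by (auto simp: N_def)
  define \<kappa> where "\<kappa> = superharmonicity_constant CARD('n) \<alpha> \<tau>"
  have p: "p > 1"
  proof -
    have "1 < N / (N - 2 * \<alpha>)" using N assms(2) by (simp add: field_simps)
    then show ?thesis using N(3) by linarith
  qed
  \<comment> \<open>The lower bound on \<open>p\<close> in product form; multiplied out against
    -\<tau> \<ge> N - 2\<alpha> it yields the comparison of exponents below.\<close>
  have N_p: "2 * \<alpha> \<le> (N - 2 * \<alpha>) * (p - 1)" using N by (simp add: field_simps)
  have exponent: "\<tau> * p \<le> \<tau> - 2 * \<alpha>" if "\<tau> \<le> 2 * \<alpha> - N"
    using that p N_p mult_right_mono[of "N - 2 * \<alpha>" "- \<tau>" "p - 1"] by (simp add: algebra_simps)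
  have exponent_strict: "\<tau> * p < \<tau> - 2 * \<alpha>" if "\<tau> < 2 * \<alpha> - N"
    using that p N_p mult_strict_right_mono[of "N - 2 * \<alpha>" "- \<tau>" "p - 1"] by (simp add: algebra_simps)
  let ?q = "\<lambda>u x. ereal (u x * norm x powr (- \<tau>))"
  assume "\<exists>u. singular_solution \<alpha> p \<Omega> u \<and> 0 < Liminf (at 0) (?q u) \<and>
      Liminf (at 0) (?q u) \<le> Limsup (at 0) (?q u) \<and> Limsup (at 0) (?q u) < \<infinity>"
  then obtain u where sol: "singular_solution \<alpha> p \<Omega> u"
    and lim: "0 < Liminf (at 0) (?q u)" "Liminf (at 0) (?q u) \<le> Limsup (at 0) (?q u)" "Limsup (at 0) (?q u) < \<infinity>"
    by blast
  have cont: "continuous_on (UNIV - {0}) u"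
    using sol by (simp add: singular_solution_def)
  obtain A where A: "Limsup (at 0) (?q u) = ereal A"
    using lim by (cases "Limsup (at 0) (?q u)") auto
  have "A > 0" using lim A by (metis ereal_less(2) order_less_le_trans)
  obtain a where a: "0 < a" "ereal a < Liminf (at 0) (?q u)"
    using ereal_dense2[OF lim(1)] by auto
  have q_le: "u x * norm x powr (- \<tau>) \<le> c \<longleftrightarrow> u x \<le> c * norm x powr \<tau>" if "x \<noteq> 0" for x c
    using that by (simp add: powr_minus field_simps)
  obtain r1 where r1: "r1 > 0" "\<And>x. 0 < norm x \<Longrightarrow> norm x < r1 \<Longrightarrow> a * norm x powr \<tau> \<le> u x"
  proof -
    have "eventually (\<lambda>x. a < u x * norm x powr (- \<tau>)) (at 0)"
      using less_LiminfD[OF a(2)] by simp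
    then obtain r where "r > 0" "\<And>x. x \<noteq> 0 \<Longrightarrow> dist x 0 < r \<Longrightarrow> a < u x * norm x powr (- \<tau>)"
      by (auto simp: eventually_at)
    then have "a * norm x powr \<tau> \<le> u x" if "0 < norm x" "norm x < r" for x
      using that q_le[of x a] by (force simp: not_le[symmetric])
    then show ?thesis using \<open>r > 0\<close> by (rule that[rotated])
  qed
  obtain r0 where r0: "r0 > 0" "ball 0 r0 \<subseteq> \<Omega>"
    using assms openE by blast
  \<comment> \<open>Two sides of the upper limit \<open>A\<close>: a bound near 0, and in
    \<open>lower\<close> points arbitrarily close to 0 where it is almost attained. The latter
    supply \<open>x0\<close> when \<tau> \<ge> 2\<alpha> - N.\<close>
  have upper: "\<exists>\<delta>>0. \<forall>x. 0 < norm x \<longrightarrow> norm x < \<delta> \<longrightarrow> u x \<le> (A + h) * norm x powr \<tau>" if "h > 0" for h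
  proof -
    have "eventually (\<lambda>x. u x * norm x powr (- \<tau>) < A + h) (at 0)"
      using Limsup_lessD[of "at 0" "?q u" "ereal (A + h)"] that A by simp
    then obtain d where d: "d > 0" "\<And>x. x \<noteq> 0 \<Longrightarrow> dist x 0 < d \<Longrightarrow> u x * norm x powr (- \<tau>) < A + h"
      by (auto simp: eventually_at)
    then have "u x \<le> (A + h) * norm x powr \<tau>" if "0 < norm x" "norm x < d" for x
      using that q_le[of x "A + h"] less_imp_le[OF d(2)[of x]] by simp
    then show ?thesis using d(1) by blast
  qed
  have lower: "\<exists>x. 0 < norm x \<and> norm x < r \<and> (A - h) * norm x powr \<tau> \<le> u x" if "h > 0" "r > 0" for h r
  proof (rule ccontr)
    assume neg: "\<not> ?thesis"
    have "eventually (\<lambda>x. ?q u x \<le> ereal (A - h)) (at 0)"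
      unfolding eventually_at using neg \<open>r > 0\<close> q_le by (intro exI[of _ r]) (auto simp: not_le intro: less_imp_le)
    then have "Limsup (at 0) (?q u) \<le> ereal (A - h)" by (rule Limsup_bounded)
    then show False using A \<open>h > 0\<close> by simp
  qed
  obtain B where B: "B \<ge> 0" "\<And>(u::real^'n \<Rightarrow> real) \<delta> C M h x0.
    continuous_on (UNIV - {0}) u \<Longrightarrow> 0 \<le> M \<Longrightarrow> 0 < h \<Longrightarrow> 0 \<le> C \<Longrightarrow>
    M = 0 \<or> 2 * \<alpha> - N \<le> \<tau> \<Longrightarrow>
    (\<And>y. 0 < norm y \<Longrightarrow> norm y < \<delta> \<Longrightarrow> u y \<le> (M + h) * norm y powr \<tau>) \<Longrightarrow>
    (\<And>y. \<delta> \<le> norm y \<Longrightarrow> u y \<le> C) \<Longrightarrow>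
    (\<And>x. 0 < norm x \<Longrightarrow> norm x < \<delta> \<Longrightarrow> frac_laplacian_exists \<alpha> u x) \<Longrightarrow>
    0 < norm x0 \<Longrightarrow> 2 * norm x0 < \<delta> \<Longrightarrow> (M - h) * norm x0 powr \<tau> \<le> u x0 \<Longrightarrow>
    (\<exists>x. 3 / 4 * norm x0 \<le> norm x \<and> norm x \<le> 5 / 4 * norm x0 \<and>
      - frac_laplacian \<alpha> u x \<le> - M * \<kappa> * norm x powr (\<tau> - 2 * \<alpha>)
        + B * (h * norm x0 powr (\<tau> - 2 * \<alpha>) + C * norm x0 powr (- 2 * \<alpha>)))"
    using frac_laplacian_at_touching_point[of \<alpha> \<tau>, where 'n = 'n] assms(2,3,10,11) unfolding \<kappa>_def N_def by force
  \<comment> \<open>The equation is inserted at the touching point, where u^p \<ge> a^p |x|^(\<tau>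
    p). Factoring out |x0|^(\<tau> - 2\<alpha>) leaves \<open>C\<close> with the weight
    |x0|^(-\<tau>), which tends to 0.\<close>
  have touch: "\<exists>x::real^'n. 3 / 4 * norm x0 \<le> norm x \<and> norm x \<le> 5 / 4 * norm x0 \<and>
      M * \<kappa> * norm x powr (\<tau> - 2 * \<alpha>) + a powr p * norm x powr (\<tau> * p)
        \<le> B * (h + C * norm x0 powr (- \<tau>)) * norm x0 powr (\<tau> - 2 * \<alpha>)"
    if M: "0 \<le> M" "M = 0 \<or> 2 * \<alpha> - N \<le> \<tau>" and h: "0 < h" and C: "0 \<le> C" and \<delta>: "\<delta> \<le> r0" "\<delta> \<le> r1"
      and up: "\<And>y. 0 < norm y \<Longrightarrow> norm y < \<delta> \<Longrightarrow> u y \<le> (M + h) * norm y powr \<tau>"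
      and far: "\<And>y. \<delta> \<le> norm y \<Longrightarrow> u y \<le> C"
      and x0: "0 < norm x0" "2 * norm x0 < \<delta>" "(M - h) * norm x0 powr \<tau> \<le> u x0"
    for M h C \<delta> x0
  proof -
    have pde: "frac_laplacian_exists \<alpha> u x \<and> frac_laplacian \<alpha> u x + \<bar>u x\<bar> powr (p - 1) * u x = 0"
      if "0 < norm x" "norm x < \<delta>" for x
    proof -
      have "x \<in> \<Omega> - {0}" using that r0 \<delta> by (auto simp: subset_iff)
      then show ?thesis using sol unfolding singular_solution_def by blast
    qed
    obtain x where x: "3 / 4 * norm x0 \<le> norm x" "norm x \<le> 5 / 4 * norm x0"
      "- frac_laplacian \<alpha> u x \<le> - M * \<kappa> * norm x powr (\<tau> - 2 * \<alpha>)
        + B * (h * norm x0 powr (\<tau> - 2 * \<alpha>) + C * norm x0 powr (- 2 * \<alpha>))"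
      using B(2)[OF cont M(1) h C M(2) up far _ x0] pde by blast
    have nx: "0 < norm x" "norm x < \<delta>" using x(1,2) x0(1,2) by linarith+
    have ux: "a * norm x powr \<tau> \<le> u x" using r1(2)[OF nx(1)] nx(2) \<delta>(2) by linarith
    moreover have "0 < a * norm x powr \<tau>" using a nx by simp
    ultimately have ux0: "0 < u x" by linarith
    have "a powr p * norm x powr (\<tau> * p) = (a * norm x powr \<tau>) powr p"
      using a by (simp add: powr_mult powr_powr)
    also have "\<dots> \<le> u x powr p" using ux a p by (intro powr_mono2) auto
    also have "\<dots> = \<bar>u x\<bar> powr (p - 1) * u x"
      using ux0 by (simp add: powr_diff)
    also have "\<dots> = - frac_laplacian \<alpha> u x" using pde[OF nx] by simp
    finally have "M * \<kappa> * norm x powr (\<tau> - 2 * \<alpha>) + a powr p * norm x powr (\<tau> * p)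
      \<le> B * (h * norm x0 powr (\<tau> - 2 * \<alpha>) + C * norm x0 powr (- 2 * \<alpha>))"
      using x(3) by simp
    also have "norm x0 powr (- 2 * \<alpha>) = norm x0 powr (- \<tau>) * norm x0 powr (\<tau> - 2 * \<alpha>)"
      by (simp flip: powr_add)
    finally show ?thesis using x(1,2) by (intro exI[of _ x]) (simp add: algebra_simps)
  qed
  have powr_ge: "(5 / 4) powr s * norm x0 powr s \<le> norm x powr s"
    if "s \<le> 0" "3 / 4 * norm x0 \<le> norm x" "norm x \<le> 5 / 4 * norm x0" "0 < norm x0" for s and x x0 :: "real^'n"
  proof -
    have "(5 / 4 * norm x0) powr s \<le> norm x powr s"
      using that by (intro powr_mono2') linarith+
    then show ?thesis by (simp only: powr_mult)
  qed
  have small: "\<exists>\<rho>>0. \<forall>R. 0 < R \<longrightarrow> R < \<rho> \<longrightarrow> c * R powr e < d" if "e > 0" "d > 0" for c d e :: real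
  proof -
    have "((\<lambda>R. c * R powr e) \<longlongrightarrow> c * 0 powr e) (at_right 0)"
      using \<open>e > 0\<close> by (intro tendsto_mult tendsto_const tendsto_powr2 tendsto_ident_at)
        (auto simp: eventually_at_right_field intro!: exI[of _ 1])
    then have "eventually (\<lambda>R. c * R powr e < d) (at_right 0)"
      using \<open>d > 0\<close> by (intro order_tendstoD) auto
    then show ?thesis by (auto simp: eventually_at_right_field)
  qed
  show False
  proof (cases "\<tau> < 2 * \<alpha> - N")
    case True
    \<comment> \<open>The gap between the two exponents: after division by |x0|^(\<tau> p) the right
      side carries the positive power |x0|^\<theta>.\<close>
    define \<theta> where "\<theta> = \<tau> - 2 * \<alpha> - \<tau> * p"
    have \<theta>: "\<theta> > 0" using exponent_strict[OF True] by (simp add: \<theta>_def)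
    have tp: "\<tau> * p \<le> 0" using p assms(11) by (simp add: mult_le_0_iff)
    obtain \<delta>1 where \<delta>1: "\<delta>1 > 0" "\<And>x. 0 < norm x \<Longrightarrow> norm x < \<delta>1 \<Longrightarrow> u x \<le> (A + 1) * norm x powr \<tau>"
      using upper[of 1] by auto
    define \<delta> where "\<delta> = min \<delta>1 (min r0 r1)"
    have \<delta>: "\<delta> > 0" "\<delta> \<le> \<delta>1" "\<delta> \<le> r0" "\<delta> \<le> r1" using \<delta>1 r0 r1 by (auto simp: \<delta>_def)
    obtain C where C: "C \<ge> 0" "\<And>y. \<delta> \<le> norm y \<Longrightarrow> u y \<le> C"
      using singular_solution_bounded_above_off_0[OF sol assms(6) \<delta>(1)] by blast
    define c0 where "c0 = a powr p * (5 / 4) powr (\<tau> * p)"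
    have c0: "c0 > 0" using a by (simp add: c0_def)
    obtain \<rho>1 where \<rho>1: "\<rho>1 > 0" "\<And>R. 0 < R \<Longrightarrow> R < \<rho>1 \<Longrightarrow> B * (A + 1) * R powr \<theta> < c0 / 2"
      using small[OF \<theta>, of "c0 / 2"] c0 by auto
    obtain \<rho>2 where \<rho>2: "\<rho>2 > 0" "\<And>R. 0 < R \<Longrightarrow> R < \<rho>2 \<Longrightarrow> B * C * R powr (\<theta> - \<tau>) < c0 / 2"
      using small[of "\<theta> - \<tau>" "c0 / 2"] c0 \<theta> assms(11) by auto
    obtain x0 :: "real^'n" where x0: "norm x0 = min (\<delta> / 3) (min (\<rho>1 / 2) (\<rho>2 / 2))"
      using vector_choose_size[of "min (\<delta> / 3) (min (\<rho>1 / 2) (\<rho>2 / 2))"] \<delta> \<rho>1 \<rho>2 by (metis (no_types, lifting) half_gt_zero less_eq_real_def min_def zero_less_divide_iff zero_less_numeral)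
    have x0': "0 < norm x0" "2 * norm x0 < \<delta>" "norm x0 < \<rho>1" "norm x0 < \<rho>2"
      unfolding x0 using \<delta> \<rho>1 \<rho>2 by auto
    \<comment> \<open>With M = 0 and h = A + 1 the touching condition only asks for a negative lower
      bound, so any \<open>x0\<close> close to 0 will do.\<close>
    have "(0 - (A + 1)) * norm x0 powr \<tau> \<le> 0"
      using \<open>A > 0\<close> by (intro mult_nonpos_nonneg) auto
    also have "0 \<le> a * norm x0 powr \<tau>" using a by simp
    also have "\<dots> \<le> u x0" using r1(2)[of x0] x0' \<delta> by auto
    finally obtain x :: "real^'n" where x: "3 / 4 * norm x0 \<le> norm x" "norm x \<le> 5 / 4 * norm x0"
      "a powr p * norm x powr (\<tau> * p) \<le> B * ((A + 1) + C * norm x0 powr (- \<tau>)) * norm x0 powr (\<tau> - 2 * \<alpha>)"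
      using touch[of 0 "A + 1" C \<delta> x0] \<open>A > 0\<close> C \<delta> \<delta>1(2) x0' by auto
    have "c0 * norm x0 powr (\<tau> * p) \<le> a powr p * norm x powr (\<tau> * p)"
      using mult_left_mono[OF powr_ge[OF tp x(1,2) x0'(1)], of "a powr p"] by (simp add: c0_def mult.assoc)
    also note x(3)
    also have "norm x0 powr (\<tau> - 2 * \<alpha>) = norm x0 powr \<theta> * norm x0 powr (\<tau> * p)"
      by (simp add: \<theta>_def flip: powr_add)
    finally have "c0 * norm x0 powr (\<tau> * p)
      \<le> (B * ((A + 1) + C * norm x0 powr (- \<tau>)) * norm x0 powr \<theta>) * norm x0 powr (\<tau> * p)"
      by (simp add: mult.assoc)
    then have "c0 \<le> B * ((A + 1) + C * norm x0 powr (- \<tau>)) * norm x0 powr \<theta>"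
      using x0'(1) by (subst (asm) mult_le_cancel_right_pos) auto
    also have "\<dots> = B * (A + 1) * norm x0 powr \<theta> + B * C * (norm x0 powr \<theta> * norm x0 powr (- \<tau>))"
      by (simp add: algebra_simps)
    also have "norm x0 powr \<theta> * norm x0 powr (- \<tau>) = norm x0 powr (\<theta> - \<tau>)"
      by (simp flip: powr_add)
    also have "B * (A + 1) * norm x0 powr \<theta> + B * C * norm x0 powr (\<theta> - \<tau>) < c0 / 2 + c0 / 2"
      by (intro add_strict_mono \<rho>1 \<rho>2 x0')
    finally show False by simp
  next
    case False
    define s where "s = \<tau> - 2 * \<alpha>"
    have s: "s \<le> 0" using assms by (simp add: s_def)
    \<comment> \<open>The coefficient of the dominant term on the left: absorption at the critical
      exponent, where \<kappa> = 0, and superharmonicity above it. The factor 5/4 accounts for |x|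
      \<le> 5/4 |x0|.\<close>
    define c0 where "c0 = (if \<tau> = 2 * \<alpha> - N then a powr p else A * \<kappa>) * (5 / 4) powr s"
    have c0: "c0 > 0"
      using a \<open>A > 0\<close> False superharmonicity_constant_pos[of \<tau> \<alpha> "CARD('n)"] assms(11)
      by (auto simp: c0_def \<kappa>_def N_def)
    \<comment> \<open>Chosen so that (B + 1) h = c0 / 2, hence B h < c0 / 2 even if B = 0.\<close>
    define h where "h = c0 / (2 * (B + 1))"
    have h: "h > 0" "B * h = c0 / 2 - h"
      using c0 B(1) by (auto simp: h_def field_simps add_nonneg_pos)
    obtain \<delta>1 where \<delta>1: "\<delta>1 > 0" "\<And>x. 0 < norm x \<Longrightarrow> norm x < \<delta>1 \<Longrightarrow> u x \<le> (A + h) * norm x powr \<tau>"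
      using upper[OF h(1)] by auto
    define \<delta> where "\<delta> = min \<delta>1 (min r0 r1)"
    have \<delta>: "\<delta> > 0" "\<delta> \<le> \<delta>1" "\<delta> \<le> r0" "\<delta> \<le> r1" using \<delta>1 r0 r1 by (auto simp: \<delta>_def)
    obtain C where C: "C \<ge> 0" "\<And>y. \<delta> \<le> norm y \<Longrightarrow> u y \<le> C"
      using singular_solution_bounded_above_off_0[OF sol assms(6) \<delta>(1)] by blast
    obtain \<rho> where \<rho>: "\<rho> > 0" "\<And>R. 0 < R \<Longrightarrow> R < \<rho> \<Longrightarrow> B * C * R powr (- \<tau>) < c0 / 4"
      using small[of "- \<tau>" "c0 / 4"] c0 assms(11) by auto
    \<comment> \<open>The bound 1/2 gives |x| < 1, so that the smaller exponent yields the larger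
      power in the critical case.\<close>
    obtain x0 where x0: "0 < norm x0" "norm x0 < min \<rho> (min (\<delta> / 2) (1 / 2))" "(A - h) * norm x0 powr \<tau> \<le> u x0"
      using lower[OF h(1), of "min \<rho> (min (\<delta> / 2) (1 / 2))"] \<rho>(1) \<delta>(1) by auto
    obtain x :: "real^'n" where x: "3 / 4 * norm x0 \<le> norm x" "norm x \<le> 5 / 4 * norm x0"
      "A * \<kappa> * norm x powr s + a powr p * norm x powr (\<tau> * p) \<le> B * (h + C * norm x0 powr (- \<tau>)) * norm x0 powr s"
      using touch[of A h C \<delta> x0] \<open>A > 0\<close> C \<delta> \<delta>1(2) x0 False h(1) unfolding s_def by auto
    have \<kappa>: "\<kappa> \<ge> 0"
      using superharmonicity_constant_nonneg[of \<tau> \<alpha> "CARD('n)"] False assms(11) by (simp add: \<kappa>_def N_def)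
    have "c0 * norm x0 powr s \<le> A * \<kappa> * norm x powr s + a powr p * norm x powr (\<tau> * p)"
    proof (cases "\<tau> = 2 * \<alpha> - N")
      case True
      have "norm x powr s \<le> norm x powr (\<tau> * p)"
        using exponent True x0 x(1,2) by (intro powr_mono') (auto simp: s_def)
      then have "a powr p * ((5 / 4) powr s * norm x0 powr s) \<le> a powr p * norm x powr (\<tau> * p)"
        using powr_ge[OF s x(1,2) x0(1)] by (intro mult_left_mono) auto
      then show ?thesis using True \<kappa> \<open>A > 0\<close> by (simp add: c0_def mult.assoc add_increasing)
    next
      case False
      have "A * \<kappa> * ((5 / 4) powr s * norm x0 powr s) \<le> A * \<kappa> * norm x powr s"
        using powr_ge[OF s x(1,2) x0(1)] \<kappa> \<open>A > 0\<close> by (intro mult_left_mono) auto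
      then show ?thesis using False by (simp add: c0_def mult.assoc add_increasing2)
    qed
    also note x(3)
    finally have "c0 \<le> B * (h + C * norm x0 powr (- \<tau>))"
      using x0(1) by (subst (asm) mult_le_cancel_right_pos) auto
    also have "\<dots> = B * h + B * C * norm x0 powr (- \<tau>)" by (simp add: algebra_simps)
    \<comment> \<open>The error terms add up to less than 3/4 of \<open>c0\<close>, which
      contradicts \<open>c0\<close> being a lower bound.\<close>
    also have "\<dots> < c0 / 2 + c0 / 4"
      using \<rho>(2)[of "norm x0"] x0 h by simp
    finally show False using c0 by simp
  qed
qed

end
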